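(* Let $\{a_n\}_{n\ge1}$ be a sequence of nonzero complex numbers, and let $f(z)$ be an entire function with zeros at $\{a_n\}$ listed according to their multiplicities. Suppose $f$ has a zero of order $k\ge0$ at the origin. Let $X$ be a graphical isotropic minimal surface with height function $h(x,y)=\operatorname{Re}(\ln f(z))$. If we apply a Bonnet rotation with angle $\theta$ and a López–Ros deformation with parameter $\lambda$, then the resulting isotropic minimal surface is also graphical, with height function $h_{\theta,\lambda}$. Moreover, $h_{\theta,\lambda}$ admits a decomposition on a simply connected domain excluding $\{a_n\}_{n\ge1}$ and $0$ into the following components, where $Z=A_{\mathbb C}^{-1}(x,y)$: (1) Helicoid contributions (from the $\sin\theta$ terms): (a) a finite sum representing $k$ helicoids, dilated and rotated by the linear transformation $A^{-1}$, with the height function scaled by $-\sin\theta$, given by $-\sin\theta\,[h_{\mathrm{Hel}}\circ A^{-1}](x,y)$, where $h_{\mathrm{Hel}}(x,y)=\tan^{-1}(y/x)$; (b) an infinite sum of dilated, rotated and translated helicoids, with the height function scaled by $-\sin\theta$, where each term is $-\sin\theta\,[h_{\mathrm{dil.Hel}}\circ A^{-1}](x,y)$ with $$h_{\mathrm{dil.Hel}}(x,y)=\tan^{-1}\!\left(\frac{a_n^2x-a_n^1y}{|a_n|^2-a_n^1x-a_n^2y}\right),$$ associated with the nonzero zeros $a_n=a_n^1+ia_n^2$ of $f$; (c) an infinite sum of graphical isotropic minimal surfaces given by the scaled harmonic polynomials $-\sin\theta\,\operatorname{Im}\!\big(P_n(\tfrac1{a_n}Z)\big)$, where $P_n$ is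 derived from the Weierstrass primary factors in the product formula for $f$; (d) a graphical isotropic minimal surface given by the scaled harmonic function $-\sin\theta\,\operatorname{Im}(g(Z))$, where $g$ is the entire function appearing in the Weierstrass product formula for $f$. (2) Logarithmoid of revolution contributions (from the $\cos\theta$ terms): (a) a finite sum representing $k$ logarithmoids of revolution, dilated and rotated by the linear transformation $A^{-1}$, with the height function scaled by $\cos\theta$, given by $\cos\theta\,[h_{\mathrm{LogRev}}\circ A^{-1}](x,y)$, where $h_{\mathrm{LogRev}}(x,y)=\ln\sqrt{x^2+y^2}$; (b) an infinite sum of dilated, rotated and translated logarithmoids of revolution, with the height function scaled by $\cos\theta$, where each term is $\cos\theta\,[h_{\mathrm{dil.LogRev}}\circ A^{-1}](x,y)$ with $$h_{\mathrm{dil.LogRev}}(x,y)=\ln\left|1-\frac{x+iy}{a_n^1+ia_n^2}\right|,$$ associated with the nonzero zeros $a_n=a_n^1+ia_n^2$ of $f$; (c) an infinite sum of graphical isotropic minimal surfaces given by the scaled harmonic polynomials $\cos\theta\,\operatorname{Re}\!\big(P_n(\tfrac1{a_n}Z)\big)$; (d) a graphical isotropic minimal surface given by the scaled harmonic function $\cos\theta\,\operatorname{Re}(g(Z))$. Furthermore, because the Weierstrass product representation of an entire function is not unique, the corresponding decomposition of the isotropic minimal surface is likewise not uniquely determined.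
   Context: Isotropic $3$-space $\mathbb I^3$ is $\mathbb R^3$ with the degenerate metric $dx^2+dy^2$; a graph $(x,y,h(x,y))$ is an isotropic minimal surface if and only if $\Delta h=0$. A graphical isotropic minimal surface has Weierstrass data of the form $(1,G)$; here $\int^w2G\,dw=\ln f(w)$. The surface obtained by Bonnet rotation with angle $\theta\in(0,2\pi]$ and López–Ros deformation with parameter $\lambda\in(0,+\infty)$ is $$X_{\theta,\lambda}=\operatorname{Re}\int^w\begin{pmatrix}1\\-i\\2\lambda G\end{pmatrix}\frac{e^{i\theta}}\lambda\,dw,\qquad w=u+iv.$$ Its first two components form the invertible linear map $A_{\mathbb C}:\mathbb C\to\mathbb R^2$, $A_{\mathbb C}(w)=\frac1\lambda(u\cos\theta-v\sin\theta,\;v\cos\theta+u\sin\theta)$, and $A=\frac1\lambda\begin{pmatrix}\cos\theta&-\sin\theta\\ \sin\theta&\cos\theta\end{pmatrix}$ is the corresponding linear map $\mathbb R^2\to\mathbb R^2$. The helicoid and the logarithmoid of revolution are the graphs of $\tan^{-1}(y/x)$ and $\ln\sqrt{x^2+y^2}$. In $a_n=a_n^1+ia_n^2$, the superscripts are indices and $a_n^1,a_n^2$ are the real and imaginary parts. The Weierstrass product formula for $f$ is $f(z)=z^ke^{g(z)}\prod_{n=1}^\infty E_n(z/a_n)$, where $g$ is entire and $E_n(w)=(1-w)e^{P_n(w)}$ is the Weierstrass primary factor, with $P_n(w)=w+\frac{w^2}2+\dots+\frac{w^n}n$.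
   Formalization: In (1) and (2) the infinite sums (b) and (c) are added jointly, term by term in n, since separately they can diverge (e.g. f=1/Γ), and tan⁻¹ is read as a continuous branch modulo π on the domain, since its principal value jumps there. *)

theory Defs
  imports "HOL-Complex_Analysis.Complex_Analysis"
begin

section \<open>Graphs and Weierstrass data in isotropic 3-space\<close>

text \<open>Over an open set, the graph of \<open>h\<close> is an isotropic minimal surface iff \<open>h\<close> is harmonic;
  the witnesses below are the continuous partial derivatives of \<open>h\<close> up to order two.\<close>

definition isotropic_minimal_graph :: "(real \<times> real) set \<Rightarrow> (real \<times> real \<Rightarrow> real) \<Rightarrow> bool" where
  "isotropic_minimal_graph U h \<longleftrightarrow> open U \<and>
     (\<exists>hx hy hxx hxy hyx hyy.
        (\<forall>q\<in>U. (h has_derivative (\<lambda>(s, t). hx q * s + hy q * t)) (at q)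
             \<and> (hx has_derivative (\<lambda>(s, t). hxx q * s + hxy q * t)) (at q)
             \<and> (hy has_derivative (\<lambda>(s, t). hyx q * s + hyy q * t)) (at q)
             \<and> hxx q + hyy q = 0)
      \<and> continuous_on U hxx \<and> continuous_on U hxy
      \<and> continuous_on U hyx \<and> continuous_on U hyy)"

definition proj_xy :: "real \<times> real \<times> real \<Rightarrow> real \<times> real" where
  "proj_xy = (\<lambda>(x, y, t). (x, y))"

definition is_graph_of ::
  "(complex \<Rightarrow> real \<times> real \<times> real) \<Rightarrow> complex set \<Rightarrow> (real \<times> real) set \<Rightarrow> (real \<times> real \<Rightarrow> real) \<Rightarrow> bool" where
  "is_graph_of X D U h \<longleftrightarrow>
     bij_betw (\<lambda>w. proj_xy (X w)) D U \<and>
     (\<forall>w\<in>D. X w = (fst (proj_xy (X w)), snd (proj_xy (X w)), h (proj_xy (X w))))"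

text \<open>\<open>\<Phi>\<close> is an indefinite integral of \<open>(1, -\<i>, 2 G) F dw\<close> on \<open>D\<close>; the surface with
  Weierstrass data \<open>(F, G)\<close> is its real part.\<close>

definition isotropic_curve ::
  "complex set \<Rightarrow> (complex \<Rightarrow> complex) \<Rightarrow> (complex \<Rightarrow> complex) \<Rightarrow> (complex \<Rightarrow> complex \<times> complex \<times> complex) \<Rightarrow> bool" where
  "isotropic_curve D F G \<Phi> \<longleftrightarrow>
     (\<forall>w\<in>D. ((\<lambda>z. fst (\<Phi> z)) has_field_derivative F w) (at w)
          \<and> ((\<lambda>z. fst (snd (\<Phi> z))) has_field_derivative - \<i> * F w) (at w)
          \<and> ((\<lambda>z. snd (snd (\<Phi> z))) has_field_derivative 2 * G w * F w) (at w))"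

definition re3 :: "complex \<times> complex \<times> complex \<Rightarrow> real \<times> real \<times> real" where
  "re3 = (\<lambda>(a, b, c). (Re a, Re b, Re c))"

text \<open>\<open>Y\<close> is \<open>Re \<integral> (1, -\<i>, 2 \<lambda> G) e\<^sup>i\<^sup>\<theta>/\<lambda> dw\<close>, where \<open>\<Phi>\<close> is the chosen indefinite integral of
  \<open>(1, -\<i>, 2 G) dw\<close>.  The constants of integration are those inherited from \<open>\<Phi>\<close>: they are
  fixed by the value at one point of the (connected) domain.\<close>

definition bonnet_lopez_ros ::
  "complex set \<Rightarrow> (complex \<Rightarrow> complex) \<Rightarrow> (complex \<Rightarrow> complex \<times> complex \<times> complex)
     \<Rightarrow> real \<Rightarrow> real \<Rightarrow> (complex \<Rightarrow> real \<times> real \<times> real) \<Rightarrow> bool" where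
  "bonnet_lopez_ros D G \<Phi> \<theta> lam Y \<longleftrightarrow>
     (\<exists>\<Psi>. isotropic_curve D (\<lambda>_. cis \<theta> / of_real lam) (\<lambda>w. of_real lam * G w) \<Psi>
        \<and> (\<exists>w\<^sub>0\<in>D. \<Psi> w\<^sub>0 = (case \<Phi> w\<^sub>0 of (a, b, c) \<Rightarrow>
                (cis \<theta> / of_real lam * a, cis \<theta> / of_real lam * b, cis \<theta> * c)))
        \<and> (\<forall>w\<in>D. Y w = re3 (\<Psi> w)))"

definition lin_AC :: "real \<Rightarrow> real \<Rightarrow> complex \<Rightarrow> real \<times> real" where
  "lin_AC \<theta> lam w = ((Re w * cos \<theta> - Im w * sin \<theta>) / lam, (Im w * cos \<theta> + Re w * sin \<theta>) / lam)"

definition lin_A :: "real \<Rightarrow> real \<Rightarrow> real \<times> real \<Rightarrow> real \<times> real" where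
  "lin_A \<theta> lam = (\<lambda>(u, v). ((cos \<theta> * u - sin \<theta> * v) / lam, (sin \<theta> * u + cos \<theta> * v) / lam))"


section \<open>Helicoids and logarithmoids of revolution\<close>

text \<open>A continuous branch \<open>H\<close> on the open set \<open>S\<close> of the multivalued function
  \<open>tan\<^sup>-\<^sup>1 (num/den)\<close>, whose values differ by integer multiples of \<open>\<pi>\<close>.  Where \<open>den\<close> vanishes (below: on
  a line) the quotient is infinite and \<open>H\<close> is determined by continuity.\<close>

definition arctan_branch ::
  "(real \<times> real) set \<Rightarrow> (real \<times> real \<Rightarrow> real) \<Rightarrow> (real \<times> real \<Rightarrow> real) \<Rightarrow> (real \<times> real \<Rightarrow> real) \<Rightarrow> bool" where
  "arctan_branch S num den H \<longleftrightarrow>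
     continuous_on S H \<and>
     (\<forall>q\<in>S. den q \<noteq> 0 \<longrightarrow> (\<exists>m::int. H q = arctan (num q / den q) + of_int m * pi))"

definition helicoid :: "(real \<times> real) set \<Rightarrow> (real \<times> real \<Rightarrow> real) \<Rightarrow> bool" where
  "helicoid S H \<longleftrightarrow> arctan_branch S (\<lambda>(x, y). y) (\<lambda>(x, y). x) H"

definition dil_helicoid :: "complex \<Rightarrow> (real \<times> real) set \<Rightarrow> (real \<times> real \<Rightarrow> real) \<Rightarrow> bool" where
  "dil_helicoid a S H \<longleftrightarrow>
     arctan_branch S (\<lambda>(x, y). Im a * x - Re a * y)
                     (\<lambda>(x, y). (cmod a)\<^sup>2 - Re a * x - Im a * y) H"

definition log_rev :: "real \<times> real \<Rightarrow> real" where
  "log_rev = (\<lambda>(x, y). ln (sqrt (x\<^sup>2 + y\<^sup>2)))"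

definition dil_log_rev :: "complex \<Rightarrow> real \<times> real \<Rightarrow> real" where
  "dil_log_rev a = (\<lambda>(x, y). ln (cmod (1 - Complex x y / a)))"

text \<open>Compositions of dilations, rotations and translations of the plane.\<close>

definition plane_similarity :: "(real \<times> real \<Rightarrow> real \<times> real) \<Rightarrow> bool" where
  "plane_similarity T \<longleftrightarrow>
     (\<exists>r \<alpha> s t. r > 0 \<and>
        (\<forall>x y. T (x, y) = (r * (x * cos \<alpha> - y * sin \<alpha>) + s, r * (x * sin \<alpha> + y * cos \<alpha>) + t)))"


section \<open>Weierstrass products and the decomposition\<close>

text \<open>Sequences of zeros are indexed from 1; their value at 0 is irrelevant.  The listing
  takes multiplicities into account, and only concerns the zeros away from the origin.\<close>

definition lists_nonzero_zeros :: "(nat \<Rightarrow> complex) \<Rightarrow> (complex \<Rightarrow> complex) \<Rightarrow> bool" where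
  "lists_nonzero_zeros a f \<longleftrightarrow>
     (\<forall>n\<ge>1. a n \<noteq> 0) \<and>
     (\<forall>z. z \<noteq> 0 \<longrightarrow> finite {n. n \<ge> 1 \<and> a n = z} \<and> int (card {n. n \<ge> 1 \<and> a n = z}) = zorder f z)"

definition weierstrass_poly :: "nat \<Rightarrow> complex \<Rightarrow> complex" where
  "weierstrass_poly n w = (\<Sum>j=1..n. w ^ j / of_nat j)"

text \<open>The general Weierstrass product \<open>f(z) = z\<^sup>k e\<^sup>g\<^sup>(\<^sup>z\<^sup>) \<Prod> E (p n) (z / b n)\<close>, with the \<open>n\<close>-th primary
  factor of degree \<open>p n\<close>; the standard choice is \<open>p n = n\<close>.\<close>

definition weierstrass_representation ::
  "(complex \<Rightarrow> complex) \<Rightarrow> nat \<Rightarrow> (nat \<Rightarrow> complex) \<Rightarrow> (nat \<Rightarrow> nat) \<Rightarrow> (complex \<Rightarrow> complex) \<Rightarrow> bool" where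
  "weierstrass_representation f k b p g \<longleftrightarrow>
     g holomorphic_on UNIV \<and>
     (\<forall>z. \<exists>Q. (\<lambda>n. weierstrass_factor (p (Suc n)) (z / b (Suc n))) has_prod Q
            \<and> f z = z ^ k * exp (g z) * Q)"

text \<open>The two infinite families belonging to the helicoids (and likewise to the logarithmoids) are
  summed jointly over \<open>n\<close>: the polynomials are what makes the series converge, and the series of
  helicoids alone diverges in general.\<close>

definition isotropic_decomposition ::
  "real \<Rightarrow> real \<Rightarrow> (real \<times> real) set \<Rightarrow> nat \<Rightarrow> (nat \<Rightarrow> complex) \<Rightarrow> (nat \<Rightarrow> nat)
     \<Rightarrow> (complex \<Rightarrow> complex) \<Rightarrow> (real \<times> real \<Rightarrow> real) \<Rightarrow> bool" where
  "isotropic_decomposition \<theta> lam U k b p g h \<longleftrightarrow>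
     (let Ainv = inv (lin_A \<theta> lam); Z = inv (lin_AC \<theta> lam); S = Ainv ` U;
          P = (\<lambda>n q. weierstrass_poly (p n) (1 / b n * Z q))
      in \<exists>Hel dHel.
        helicoid S Hel \<and>
        (\<forall>n\<ge>1. dil_helicoid (b n) S (dHel n)) \<and>
        (\<forall>n\<ge>1. \<exists>T K. plane_similarity T \<and> helicoid (T ` S) K \<and>
             (\<forall>q\<in>S. dHel n q = K (T q)) \<and> (\<forall>q. dil_log_rev (b n) q = log_rev (T q))) \<and>
        isotropic_minimal_graph U (\<lambda>q. - sin \<theta> * Hel (Ainv q)) \<and>
        (\<forall>n\<ge>1. isotropic_minimal_graph U (\<lambda>q. - sin \<theta> * dHel n (Ainv q))) \<and>
        (\<forall>n\<ge>1. isotropic_minimal_graph UNIV (\<lambda>q. - sin \<theta> * Im (P n q))) \<and>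
        isotropic_minimal_graph UNIV (\<lambda>q. - sin \<theta> * Im (g (Z q))) \<and>
        isotropic_minimal_graph U (\<lambda>q. cos \<theta> * log_rev (Ainv q)) \<and>
        (\<forall>n\<ge>1. isotropic_minimal_graph U (\<lambda>q. cos \<theta> * dil_log_rev (b n) (Ainv q))) \<and>
        (\<forall>n\<ge>1. isotropic_minimal_graph UNIV (\<lambda>q. cos \<theta> * Re (P n q))) \<and>
        isotropic_minimal_graph UNIV (\<lambda>q. cos \<theta> * Re (g (Z q))) \<and>
        (\<forall>q\<in>U.
           summable (\<lambda>n. - sin \<theta> * dHel (Suc n) (Ainv q) + - sin \<theta> * Im (P (Suc n) q)) \<and>
           summable (\<lambda>n. cos \<theta> * dil_log_rev (b (Suc n)) (Ainv q) + cos \<theta> * Re (P (Suc n) q)) \<and>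
           h q = ((\<Sum>j=1..k. - sin \<theta> * Hel (Ainv q))
                  + (\<Sum>n. - sin \<theta> * dHel (Suc n) (Ainv q) + - sin \<theta> * Im (P (Suc n) q))
                  + - sin \<theta> * Im (g (Z q)))
               + ((\<Sum>j=1..k. cos \<theta> * log_rev (Ainv q))
                  + (\<Sum>n. cos \<theta> * dil_log_rev (b (Suc n)) (Ainv q) + cos \<theta> * Re (P (Suc n) q))
                  + cos \<theta> * Re (g (Z q)))))"

text \<open>The entire-function components given by \<open>g\<close> and \<open>g'\<close> differ over \<open>U\<close>, not merely by
  vertical translations (such as those coming from \<open>g' = g + 2 \<pi> \<i>\<close>).\<close>

definition different_entire_parts ::
  "real \<Rightarrow> real \<Rightarrow> (real \<times> real) set \<Rightarrow> (complex \<Rightarrow> complex) \<Rightarrow> (complex \<Rightarrow> complex) \<Rightarrow> bool" where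
  "different_entire_parts \<theta> lam U g g' \<longleftrightarrow>
     (let Z = inv (lin_AC \<theta> lam)
      in \<not> (\<exists>c d. \<forall>q\<in>U. - sin \<theta> * Im (g' (Z q)) = - sin \<theta> * Im (g (Z q)) + c
                     \<and> cos \<theta> * Re (g' (Z q)) = cos \<theta> * Re (g (Z q)) + d))"

end

theory Submission
  imports Defs
begin

text \<open>The deformed surface has height \<open>Re (e\<^sup>i\<^sup>\<theta> L)\<close> over the rotated and dilated domain, where \<open>L\<close> is
  the given branch of \<open>log f\<close>.  Taking logarithms in the Weierstrass product writes \<open>L\<close> as
  \<open>k log z + g + \<Sum>n. (log (1 - z/a\<^sub>n) + P\<^sub>n (z/a\<^sub>n))\<close> for suitable branches; the real parts of the
  logarithms are logarithmoids, the imaginary parts are helicoids.  For non-uniqueness, a different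
  degree of one primary factor, or an exchange of two consecutive zeros of different moduli, changes \<open>g\<close> by a
  monomial \<open>c z\<^sup>m\<close> with \<open>c \<noteq> 0\<close> and \<open>m \<ge> 1\<close>.\<close>

text \<open>The domain may cross the cut of the principal logarithm of 1 - z/a_n, so the branches
  have to be chosen on \<open>D\<close> itself. Each holomorphic branch is fixed only up to a
  multiple of 2 pi i, and careless choices give a divergent series; normalising at one point cures
  the tail and leaves a single integer to adjust. That adjustment matters because the given height
  has to be reproduced exactly: imaginary parts enter it through Re (e^(i theta) L) = cos theta Re L
  - sin theta Im L, which is also the source of the two families of components. The parameter lambda
  cancels in the height and survives only in the change of variable Z.\<close>

section \<open>Branches of the logarithm of an infinite product\<close>

text \<open>The values of \<open>\<phi>\<close> are multiples of 2 pi i, so distinct ones are at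
  least 2 pi apart, and a continuous function with such a range is constant on a connected set.
  Applied to a difference of two logarithms of one function, this spreads agreement at one point to
  all of \<open>C\<close>.\<close>

lemma continuous_exp_eq_1_imp_eq_0:
  fixes \<phi> :: "'a::topological_space \<Rightarrow> complex"
  assumes "connected C" "continuous_on C \<phi>" "\<And>v. v \<in> C \<Longrightarrow> exp (\<phi> v) = 1"
    and "z \<in> C" "\<phi> z = 0" "v \<in> C"
  shows "\<phi> v = 0"
proof -
  have "\<phi> constant_on C"
  proof (rule continuous_discrete_range_constant[OF assms(1,2)])
    fix x assume x: "x \<in> C"
    show "\<exists>e>0. \<forall>y. y \<in> C \<and> \<phi> y \<noteq> \<phi> x \<longrightarrow> e \<le> norm (\<phi> y - \<phi> x)"
    proof (intro exI[of _ "2 * pi"] conjI allI impI)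
      fix y assume y: "y \<in> C \<and> \<phi> y \<noteq> \<phi> x"
      have "exp (\<phi> y - \<phi> x) = 1" using assms(3) x y by (simp add: exp_diff)
      then obtain n :: int where n: "Re (\<phi> y - \<phi> x) = 0" "Im (\<phi> y - \<phi> x) = of_int (2 * n) * pi"
        by (auto simp: exp_eq_1)
      have "n \<noteq> 0" using n y by (auto simp: complex_eq_iff)
      hence "1 \<le> \<bar>real_of_int n\<bar>" by linarith
      hence "2 * pi \<le> \<bar>Im (\<phi> y - \<phi> x)\<bar>" unfolding n by (simp add: abs_mult)
      also have "\<dots> \<le> norm (\<phi> y - \<phi> x)" by (rule abs_Im_le_cmod)
      finally show "2 * pi \<le> norm (\<phi> y - \<phi> x)" .
    qed simp
  qed
  thus ?thesis using assms(4-6) by (auto simp: constant_on_def)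
qed

text \<open>Choose branches \<open>\<mu> n\<close> of \<open>log E\<^sub>n\<close> that agree with the principal value at one point \<open>z\<^sub>0\<close>.
  Along a path from \<open>z\<^sub>0\<close> all but finitely many \<open>\<mu> n\<close> stay principal, hence are controlled by
  \<open>E\<^sub>n - 1\<close>; so \<open>\<Sum>n. \<mu> n\<close> differs from \<open>L\<close> by a constant in \<open>2\<pi>\<i>\<int>\<close>, which \<open>\<mu> 0\<close> absorbs.\<close>

lemma has_prod_imp_branches_sums:
  fixes E :: "nat \<Rightarrow> complex \<Rightarrow> complex"
  assumes D: "open D" "simply_connected D"
    and hol: "\<And>n. E n holomorphic_on D"
    and nz: "\<And>n w. w \<in> D \<Longrightarrow> E n w \<noteq> 0"
    and bnd: "\<And>C. compact C \<Longrightarrow> C \<subseteq> D \<Longrightarrow>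
       \<exists>M. summable M \<and> (\<forall>\<^sub>F n in sequentially. \<forall>w\<in>C. norm (E n w - 1) \<le> M n)"
    and L: "continuous_on D L" "\<And>w. w \<in> D \<Longrightarrow> (\<lambda>n. E n w) has_prod exp (L w)"
  obtains \<mu> where "\<And>n. \<mu> n holomorphic_on D" "\<And>n w. w \<in> D \<Longrightarrow> exp (\<mu> n w) = E n w"
    "\<And>w. w \<in> D \<Longrightarrow> (\<lambda>n. \<mu> n w) sums L w"
proof (cases "D = {}")
  case True
  show ?thesis by (rule that[of "\<lambda>_ _. 0"]) (auto simp: True)
next
  case False
  then obtain z where z: "z \<in> D" by blast
  have "\<exists>l. l holomorphic_on D \<and> (\<forall>w\<in>D. exp (l w) = E n w) \<and> l z = Ln (E n z)" for n
  proof -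
    obtain g where g: "g holomorphic_on D" "\<And>w. w \<in> D \<Longrightarrow> E n w = exp (g w)"
      using simply_connected_imp_holomorphic_log[OF hol D(2) open_imp_locally_path_connected[OF D(1)] nz]
      by blast
    have "exp (Ln (E n z) - g z) = 1" using z nz g by (simp add: exp_diff)
    thus ?thesis using g z
      by (intro exI[of _ "\<lambda>w. g w + (Ln (E n z) - g z)"])
        (auto intro!: holomorphic_intros simp: exp_add)
  qed
  then obtain l where l: "\<And>n. l n holomorphic_on D" "\<And>n w. w \<in> D \<Longrightarrow> exp (l n w) = E n w"
      "\<And>n. l n z = Ln (E n z)" by metis
  have main: "summable (\<lambda>n. l n w) \<and> exp (\<Sum>n. l n w) = exp (L w) \<and>
      (\<Sum>n. l n w) - L w = (\<Sum>n. l n z) - L z" if w: "w \<in> D" for w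
  proof -
    \<comment> \<open>\<open>bnd\<close> asks for a compact set, the comparison of branches for a
      connected set containing \<open>z\<close> and \<open>w\<close>; the image of a path is
      both.\<close>
    obtain \<gamma> where \<gamma>: "path \<gamma>" "path_image \<gamma> \<subseteq> D" "pathstart \<gamma> = z" "pathfinish \<gamma> = w"
      using simply_connected_imp_path_connected[OF D(2)] z w unfolding path_connected_def by blast
    define C where "C = path_image \<gamma>"
    have C: "compact C" "connected C" "C \<subseteq> D" "z \<in> C" "w \<in> C"
      using \<gamma> by (auto simp: C_def compact_path_image connected_path_image)
    obtain M where M: "summable M" "\<forall>\<^sub>F n in sequentially. \<forall>v\<in>C. norm (E n v - 1) \<le> M n"
      using bnd[OF C(1,3)] by blast
    \<comment> \<open>Within distance 1/2 of 1 a factor lies in the right half plane, where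
      \<open>Ln\<close> is continuous, and \<open>norm_Ln_le\<close> bounds its logarithm by twice
      that distance.\<close>
    have "\<forall>\<^sub>F n in sequentially. M n < 1/2"
      using summable_LIMSEQ_zero[OF M(1)] by (rule order_tendstoD) simp
    with M(2) have ev: "\<forall>\<^sub>F n in sequentially. \<forall>v\<in>C. norm (l n v) \<le> 2 * M n"
    proof eventually_elim
      case (elim n)
      have small: "norm (E n v - 1) < 1/2" if "v \<in> C" for v using elim that by fastforce
      have pos: "E n v \<notin> \<real>\<^sub>\<le>\<^sub>0" if "v \<in> C" for v
      proof -
        have "1 - Re (E n v) \<le> norm (E n v - 1)"
          using abs_Re_le_cmod[of "E n v - 1"] by simp
        hence "Re (E n v) > 0" using small[OF that] by simp
        thus ?thesis by (auto simp: complex_nonpos_Reals_iff)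
      qed
      have "l n v - Ln (E n v) = 0" if "v \<in> C" for v
      proof (rule continuous_exp_eq_1_imp_eq_0[OF C(2) _ _ C(4) _ that])
        show "continuous_on C (\<lambda>v. l n v - Ln (E n v))"
          using holomorphic_on_imp_continuous_on[OF l(1)[of n]] holomorphic_on_imp_continuous_on[OF hol[of n]] C(3) pos
          by (intro continuous_intros) (auto intro: continuous_on_subset)
        show "exp (l n v - Ln (E n v)) = 1" if "v \<in> C" for v
          using that C(3) l(2)[of v n] nz[of v n] by (auto simp: exp_diff)
      qed (use l(3) in simp)
      moreover have "norm (Ln (E n v)) \<le> 2 * norm (E n v - 1)" if "v \<in> C" for v
        using norm_Ln_le[OF small[OF that]] by simp
      ultimately show ?case using elim by fastforce
    qed
    have sm: "summable (\<lambda>n. 2 * M n)" using M(1) by (rule summable_mult)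
    have summ: "summable (\<lambda>n. l n v)" if "v \<in> C" for v
      by (rule summable_comparison_test_ev[OF _ sm]) (use ev that in \<open>auto elim: eventually_mono\<close>)
    have ul: "uniform_limit C (\<lambda>N v. \<Sum>i<N. l i v) (\<lambda>v. \<Sum>i. l i v) sequentially"
      by (rule Weierstrass_m_test_ev[OF ev sm])
    have cont: "continuous_on C (\<lambda>v. \<Sum>i. l i v)"
      by (rule uniform_limit_theorem[OF _ ul])
        (use C(3) in \<open>auto intro!: always_eventually continuous_intros
           intro: continuous_on_subset[OF holomorphic_on_imp_continuous_on[OF l(1)]]\<close>)
    have ex: "exp (\<Sum>n. l n v) = exp (L v)" if "v \<in> C" for v
    proof (rule LIMSEQ_unique)
      have v: "v \<in> D" using that C by auto
      show "(\<lambda>N. \<Prod>n<N. E n v) \<longlonglongrightarrow> exp (L v)"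
        by (rule has_prod_imp_tendsto'[OF L(2)[OF v]])
      have "(\<lambda>N. exp (\<Sum>n<N. l n v)) \<longlonglongrightarrow> exp (\<Sum>n. l n v)"
        by (intro tendsto_exp summable_LIMSEQ summ that)
      thus "(\<lambda>N. \<Prod>n<N. E n v) \<longlonglongrightarrow> exp (\<Sum>n. l n v)"
        using v by (simp add: exp_sum l(2))
    qed
    have "((\<Sum>n. l n w) - L w) - ((\<Sum>n. l n z) - L z) = 0"
    proof (rule continuous_exp_eq_1_imp_eq_0[OF C(2) _ _ C(4) _ C(5)])
      show "continuous_on C (\<lambda>v. ((\<Sum>n. l n v) - L v) - ((\<Sum>n. l n z) - L z))"
        by (intro continuous_intros cont continuous_on_subset[OF L(1) C(3)])
      show "exp (((\<Sum>n. l n v) - L v) - ((\<Sum>n. l n z) - L z)) = 1" if "v \<in> C" for v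
        using ex[OF that] ex[OF C(4)] by (simp add: exp_diff)
    qed simp
    thus ?thesis using summ[OF C(5)] ex[OF C(5)] by simp
  qed
  define c where "c = (\<Sum>n. l n z) - L z"
  have c: "exp c = 1" using main[OF z] by (simp add: c_def exp_diff)
  define \<mu> where "\<mu> = (\<lambda>n w. l n w - (if n = 0 then c else 0))"
  show ?thesis
  proof
    show "\<mu> n holomorphic_on D" for n unfolding \<mu>_def by (intro holomorphic_intros l)
    show "exp (\<mu> n w) = E n w" if "w \<in> D" for n w
      using c l(2)[OF that] by (simp add: \<mu>_def exp_diff)
    show "(\<lambda>n. \<mu> n w) sums L w" if "w \<in> D" for w
    proof -
      have "(\<lambda>n. \<mu> n w) sums ((\<Sum>n. l n w) - c)"
        unfolding \<mu>_def using main[OF that]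
        by (intro sums_diff summable_sums) (auto intro: sums_single[of 0 "\<lambda>_. c", simplified])
      moreover have "(\<Sum>n. l n w) - c = L w" using main[OF that] by (simp add: c_def algebra_simps)
      ultimately show ?thesis by simp
    qed
  qed
qed

section \<open>Isotropic graphs, helicoids and logarithmoids\<close>

text \<open>With the plane read as the complex numbers, \<open>lin_AC\<close> is multiplication by
  e^(i theta)/lam, so its inverse is multiplication by the reciprocal.\<close>

lemma
  assumes "0 < lam"
  shows bij_lin_AC: "bij (lin_AC \<theta> lam)"
    and inv_lin_AC: "inv (lin_AC \<theta> lam) = (\<lambda>q. of_real lam * cis (- \<theta>) * Complex (fst q) (snd q))"
proof -
  define g where "g = (\<lambda>q. of_real lam * cis (- \<theta>) * Complex (fst q) (snd q))"
  have lin: "lin_AC \<theta> lam w = (Re (cis \<theta> * w / of_real lam), Im (cis \<theta> * w / of_real lam))" for w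
    by (auto simp: lin_AC_def algebra_simps)
  have gl: "g (lin_AC \<theta> lam w) = w" for w
    using assms by (simp only: g_def lin fst_conv snd_conv complex_surj) (simp add: cis_mult flip: mult.assoc)
  have lg: "lin_AC \<theta> lam (g q) = q" for q
  proof -
    have "cis \<theta> * g q / of_real lam = Complex (fst q) (snd q)"
      using assms by (simp add: g_def cis_mult mult.left_commute flip: mult.assoc)
    thus ?thesis by (simp only: lin) simp
  qed
  show "bij (lin_AC \<theta> lam)" by (rule o_bij[of g]) (auto simp: gl lg)
  show "inv (lin_AC \<theta> lam) = g" by (rule inv_equality[OF gl lg])
qed

lemma inv_lin_AC_image:
  assumes "0 < lam"
  shows "q \<in> lin_AC \<theta> lam ` D \<longleftrightarrow> inv (lin_AC \<theta> lam) q \<in> D"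
proof -
  note bij = bij_lin_AC[OF assms, of \<theta>]
  show ?thesis
    using inv_f_f[OF bij_is_inj[OF bij]] surj_f_inv_f[OF bij_is_surj[OF bij], of q] by force
qed

lemma open_lin_AC_image:
  assumes "0 < lam" "open D"
  shows "open (lin_AC \<theta> lam ` D)"
proof -
  define g where "g = (\<lambda>q :: real \<times> real. of_real lam * cis (- \<theta>) * Complex (fst q) (snd q))"
  have "lin_AC \<theta> lam ` D = g -` D"
    using inv_lin_AC_image[OF assms(1), of _ \<theta> D] unfolding inv_lin_AC[OF assms(1)] g_def by blast
  moreover have "continuous_on UNIV g"
    unfolding g_def Complex_eq by (intro continuous_intros)
  ultimately show ?thesis using open_vimage[OF assms(2), of g] by simp
qed

lemma inv_lin_A:
  assumes "0 < lam"
  shows "inv (lin_A \<theta> lam) = (\<lambda>q. (Re (inv (lin_AC \<theta> lam) q), Im (inv (lin_AC \<theta> lam) q)))"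
proof (rule inv_equality)
  have *: "lin_A \<theta> lam q = lin_AC \<theta> lam (Complex (fst q) (snd q))" for q
    by (auto simp: lin_A_def lin_AC_def case_prod_unfold mult.commute)
  have bij: "bij (lin_AC \<theta> lam)" by (rule bij_lin_AC[OF assms])
  show "(Re (inv (lin_AC \<theta> lam) (lin_A \<theta> lam q)), Im (inv (lin_AC \<theta> lam) (lin_A \<theta> lam q))) = q" for q
    using bij by (simp add: * bij_is_inj inv_f_f)
  show "lin_A \<theta> lam (Re (inv (lin_AC \<theta> lam) q), Im (inv (lin_AC \<theta> lam) q)) = q" for q
    using bij by (simp add: * bij_is_surj surj_f_inv_f)
qed

text \<open>By the chain rule, differentiating F(m(x + iy)) in x multiplies F' by m and in y by i m.
  The second derivatives thus carry m^2 and -m^2, and their sum vanishes.\<close>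

lemma isotropic_minimal_graph_Re:
  assumes U: "open U" and V: "open V" and F: "F holomorphic_on V"
    and h: "\<And>q. q \<in> U \<Longrightarrow> m * Complex (fst q) (snd q) \<in> V"
      "\<And>q. q \<in> U \<Longrightarrow> h q = Re (F (m * Complex (fst q) (snd q)))"
  shows "isotropic_minimal_graph U h"
proof -
  define \<phi> where "\<phi> q = m * Complex (fst q) (snd q)" for q :: "real \<times> real"
  have lin: "(\<phi> has_derivative \<phi>) (at q)" for q
    unfolding \<phi>_def Complex_eq by (auto intro!: derivative_eq_intros)
  \<comment> \<open>The constant \<open>c\<close> is 1 or \<open>\<i>\<close>, according to the
    partial derivative already taken, so one formula covers first and second order.\<close>
  have der: "((\<lambda>q. Re (c * H (\<phi> q))) has_derivative
      (\<lambda>(s, t). Re (c * (m * deriv H (\<phi> q))) * s + Re (c * (\<i> * (m * deriv H (\<phi> q)))) * t)) (at q)"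
    if H: "H holomorphic_on V" and q: "q \<in> U" for H c q
  proof -
    have "(H has_field_derivative deriv H (\<phi> q)) (at (\<phi> q))"
      using holomorphic_derivI[OF H V] h(1)[OF q] by (simp add: \<phi>_def)
    hence "((\<lambda>q. H (\<phi> q)) has_derivative (\<lambda>u. deriv H (\<phi> q) * \<phi> u)) (at q)"
      using has_derivative_compose[OF lin] unfolding has_field_derivative_def by blast
    hence "((\<lambda>q. Re (c * H (\<phi> q))) has_derivative (\<lambda>u. Re (c * (deriv H (\<phi> q) * \<phi> u)))) (at q)"
      by (intro has_derivative_Re has_derivative_mult_right)
    moreover have "(\<lambda>u. Re (c * (deriv H (\<phi> q) * \<phi> u))) =
        (\<lambda>(s, t). Re (c * (m * deriv H (\<phi> q))) * s + Re (c * (\<i> * (m * deriv H (\<phi> q)))) * t)"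
      by (auto simp: \<phi>_def fun_eq_iff algebra_simps)
    ultimately show ?thesis by simp
  qed
  define F1 where "F1 z = m * deriv F z" for z
  define F2 where "F2 z = m * deriv F1 z" for z
  have F1: "F1 holomorphic_on V" unfolding F1_def
    by (intro holomorphic_intros holomorphic_deriv F V)
  have F2: "F2 holomorphic_on V" unfolding F2_def
    by (intro holomorphic_intros holomorphic_deriv F1 V)
  have cont: "continuous_on U (\<lambda>q. Re (c * F2 (\<phi> q)))" for c
  proof -
    have "continuous_on U \<phi>"
      using lin by (meson has_derivative_continuous continuous_at_imp_continuous_on)
    hence "continuous_on U (\<lambda>q. F2 (\<phi> q))"
      by (rule continuous_on_compose2[OF holomorphic_on_imp_continuous_on[OF F2]])
        (use h(1) in \<open>auto simp: \<phi>_def\<close>)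
    thus ?thesis by (intro continuous_intros)
  qed
  show ?thesis unfolding isotropic_minimal_graph_def
  proof (intro conjI exI ballI)
    fix q assume q: "q \<in> U"
    show "(h has_derivative (\<lambda>(s, t). Re (1 * F1 (\<phi> q)) * s + Re (\<i> * F1 (\<phi> q)) * t)) (at q)"
    proof (rule has_derivative_transform_within_open[OF _ U q])
      show "((\<lambda>q. Re (1 * F (\<phi> q))) has_derivative
          (\<lambda>(s, t). Re (1 * F1 (\<phi> q)) * s + Re (\<i> * F1 (\<phi> q)) * t)) (at q)"
        using der[OF F q, of 1] by (simp add: F1_def)
    qed (use h(2) in \<open>simp add: \<phi>_def\<close>)
    show "((\<lambda>q. Re (1 * F1 (\<phi> q))) has_derivative
        (\<lambda>(s, t). Re (1 * F2 (\<phi> q)) * s + Re (\<i> * F2 (\<phi> q)) * t)) (at q)"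
      using der[OF F1 q, of 1] by (simp add: F2_def)
    show "((\<lambda>q. Re (\<i> * F1 (\<phi> q))) has_derivative
        (\<lambda>(s, t). Re (\<i> * F2 (\<phi> q)) * s + Re (- 1 * F2 (\<phi> q)) * t)) (at q)"
      using der[OF F1 q, of \<i>] by (simp add: F2_def)
    show "Re (1 * F2 (\<phi> q)) + Re (- 1 * F2 (\<phi> q)) = 0" by simp
  qed (rule U cont)+
qed

text \<open>The factor \<open>c\<close> lets one lemma serve both families:
  \<open>\<i> * of_real (sin \<theta>)\<close> yields - sin theta Im F, and
  \<open>of_real (cos \<theta>)\<close> yields cos theta Re F.\<close>

lemma isotropic_minimal_graph_inv_lin_AC:
  assumes lam: "0 < lam" and U: "open U" and V: "open V" and F: "F holomorphic_on V"
    and h: "\<And>q. q \<in> U \<Longrightarrow> inv (lin_AC \<theta> lam) q \<in> V"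
      "\<And>q. q \<in> U \<Longrightarrow> h q = Re (c * F (inv (lin_AC \<theta> lam) q))"
  shows "isotropic_minimal_graph U h"
  by (rule isotropic_minimal_graph_Re[OF U V, of "\<lambda>z. c * F z" "of_real lam * cis (- \<theta>)"])
    (use h F in \<open>auto simp: inv_lin_AC[OF lam] intro!: holomorphic_intros\<close>)

text \<open>As r > 0, Im l is an angle of the vector (den, num), so its tangent is num/den wherever
  den is nonzero, and angles with equal tangent differ by multiples of pi. The factor
  \<open>r\<close> allows a positive denominator to be cleared.\<close>

lemma arctan_branch_Im_log:
  assumes l: "continuous_on D l" and r: "r > 0"
    and e: "\<And>w. w \<in> D \<Longrightarrow> of_real r * exp (l w) = Complex (den (Re w, Im w)) (num (Re w, Im w))"
  shows "arctan_branch ((\<lambda>w. (Re w, Im w)) ` D) num den (\<lambda>q. Im (l (Complex (fst q) (snd q))))"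
  unfolding arctan_branch_def
proof (intro conjI ballI impI)
  show "continuous_on ((\<lambda>w. (Re w, Im w)) ` D) (\<lambda>q. Im (l (Complex (fst q) (snd q))))"
    by (intro continuous_intros continuous_on_compose2[OF l]) (auto simp: Complex_eq complex_eq[symmetric] intro!: continuous_intros)
  fix q assume "q \<in> (\<lambda>w. (Re w, Im w)) ` D" and d: "den q \<noteq> 0"
  then obtain w where w: "w \<in> D" "q = (Re w, Im w)" by blast
  define s where "s = r * exp (Re (l w))"
  have s: "s > 0" using r by (simp add: s_def)
  have dn: "den q = s * cos (Im (l w))" "num q = s * sin (Im (l w))"
    using arg_cong[OF e[OF w(1)], of Re] arg_cong[OF e[OF w(1)], of Im] w(2)
    by (simp_all add: s_def Re_exp Im_exp mult.assoc)
  have c: "cos (Im (l w)) \<noteq> 0" using d dn by auto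
  have "tan (Im (l w)) = num q / den q" using s by (simp add: dn tan_def)
  moreover have "tan (Im (l w)) = num q / den q \<and> (\<nexists>k::int. Im (l w) = pi/2 + k * pi) \<Longrightarrow> 
     \<exists>m::int. Im (l w) = arctan (num q / den q) + of_int m * pi"
    using tan_eq_arctan_Ex by auto
  moreover have "\<nexists>k::int. Im (l w) = pi/2 + k * pi"
  proof
    assume "\<exists>k::int. Im (l w) = pi/2 + k * pi"
    hence "cos (Im (l w)) = 0" by (auto simp: cos_add mult.commute[of _ pi])
    thus False using c by simp
  qed
  ultimately show "\<exists>m::int. Im (l (Complex (fst q) (snd q))) = arctan (num q / den q) + of_int m * pi"
    using w by simp
qed

lemma log_rev_eq: "log_rev q = ln (cmod (Complex (fst q) (snd q)))"
  by (auto simp: log_rev_def cmod_def case_prod_unfold)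

lemma helicoid_Im_log:
  assumes "continuous_on D l" "\<And>w. w \<in> D \<Longrightarrow> exp (l w) = w"
  shows "helicoid ((\<lambda>w. (Re w, Im w)) ` D) (\<lambda>q. Im (l (Complex (fst q) (snd q))))"
  unfolding helicoid_def by (rule arctan_branch_Im_log[OF assms(1), of 1]) (use assms(2) in auto)

text \<open>The quotient in the dilated helicoid is that of the imaginary and real parts of |a|^2 (1
  - w/a) = |a|^2 - w cnj a.\<close>

lemma dil_helicoid_Im_log:
  assumes "continuous_on D l" "\<And>w. w \<in> D \<Longrightarrow> exp (l w) = 1 - w / a" "a \<noteq> 0"
  shows "dil_helicoid a ((\<lambda>w. (Re w, Im w)) ` D) (\<lambda>q. Im (l (Complex (fst q) (snd q))))"
  unfolding dil_helicoid_def
proof (rule arctan_branch_Im_log[OF assms(1), of "(cmod a)\<^sup>2"])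
  fix w assume w: "w \<in> D"
  have "of_real ((cmod a)\<^sup>2) * (1 - w / a) = a * cnj a - w * cnj a"
    using assms(3) unfolding complex_norm_square by (simp add: field_simps)
  also have "\<dots> = of_real ((cmod a)\<^sup>2) - w * cnj a" unfolding complex_norm_square ..
  also have "\<dots> = Complex (case (Re w, Im w) of (x, y) \<Rightarrow> (cmod a)\<^sup>2 - Re a * x - Im a * y)
           (case (Re w, Im w) of (x, y) \<Rightarrow> Im a * x - Re a * y)"
    by (simp add: complex_eq_iff algebra_simps)
  finally show "of_real ((cmod a)\<^sup>2) * exp (l w) = \<dots>" using assms(2)[OF w] by simp
qed (use assms(3) in simp)

text \<open>This justifies the words "dilated, rotated and translated": the single map w -> 1 - w/a
  serves the helicoid and the logarithmoid alike. The branch on the image is \<open>l\<close>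
  transported by the inverse map v -> a (1 - v).\<close>

lemma dil_helicoid_similar:
  assumes l: "continuous_on D l" "\<And>w. w \<in> D \<Longrightarrow> exp (l w) = 1 - w / a" and a: "a \<noteq> 0"
  defines "S \<equiv> (\<lambda>w. (Re w, Im w)) ` D"
  shows "\<exists>T K. plane_similarity T \<and> helicoid (T ` S) K \<and>
     (\<forall>q\<in>S. Im (l (Complex (fst q) (snd q))) = K (T q)) \<and> (\<forall>q. dil_log_rev a q = log_rev (T q))"
proof -
  define T where "T q = (Re (1 - Complex (fst q) (snd q) / a), Im (1 - Complex (fst q) (snd q) / a))"
    for q :: "real \<times> real"
  define l' where "l' v = l (a * (1 - v))" for v
  define D' where "D' = (\<lambda>w. 1 - w / a) ` D"
  have TS: "T ` S = (\<lambda>w. (Re w, Im w)) ` D'"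
    unfolding S_def D'_def image_image by (simp add: T_def)
  have "plane_similarity T" unfolding plane_similarity_def
  proof (intro exI conjI allI)
    \<comment> \<open>The linear coefficient of the map is -1/a; its polar form supplies ratio and
      angle, and the translation vector is (1, 0).\<close>
    show "cmod (- 1 / a) > 0" using a by simp
    fix x y
    define c where "c = - 1 / a"
    have c: "cmod c * cos (Arg c) = Re c" "cmod c * sin (Arg c) = Im c"
      by (metis Re_rcis rcis_cmod_Arg) (metis Im_rcis rcis_cmod_Arg)
    have *: "1 - Complex x y / a = 1 + c * Complex x y" by (simp add: c_def)
    have "T (x, y) = (Re (1 + c * Complex x y), Im (1 + c * Complex x y))"
      by (simp only: T_def fst_conv snd_conv *)
    also have "\<dots> = (Re c * x - Im c * y + 1, Im c * x + Re c * y + 0)"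
      unfolding plus_complex.sel times_complex.sel complex.sel by simp
    also have "\<dots> = (cmod c * (x * cos (Arg c) - y * sin (Arg c)) + 1,
                 cmod c * (x * sin (Arg c) + y * cos (Arg c)) + 0)"
      unfolding c[symmetric] by (simp add: algebra_simps)
    finally show "T (x, y) = (cmod (- 1 / a) * (x * cos (Arg (- 1 / a)) - y * sin (Arg (- 1 / a))) + 1,
                 cmod (- 1 / a) * (x * sin (Arg (- 1 / a)) + y * cos (Arg (- 1 / a))) + 0)"
      unfolding c_def .
  qed
  moreover have inv: "a * (1 - (1 - w / a)) = w" for w using a by simp
  moreover have "helicoid (T ` S) (\<lambda>q. Im (l' (Complex (fst q) (snd q))))"
    unfolding TS
  proof (rule helicoid_Im_log)
    show "continuous_on D' l'" unfolding l'_def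
      by (rule continuous_on_compose2[OF l(1)]) (auto simp: D'_def a intro!: continuous_intros)
    show "exp (l' v) = v" if "v \<in> D'" for v
      using that l(2) by (auto simp: D'_def l'_def a)
  qed
  moreover have "\<forall>q\<in>S. Im (l (Complex (fst q) (snd q))) = Im (l' (Complex (fst (T q)) (snd (T q))))"
    unfolding l'_def T_def by (simp only: fst_conv snd_conv complex_surj inv) simp
  moreover have "\<forall>q. dil_log_rev a q = log_rev (T q)"
    unfolding log_rev_eq dil_log_rev_def T_def by (simp only: fst_conv snd_conv complex_surj) (simp add: case_prod_unfold)
  ultimately show ?thesis by blast
qed

section \<open>The decomposition of a Weierstrass product\<close>

lemma weierstrass_factor_eq: "weierstrass_factor n z = (1 - z) * exp (weierstrass_poly n z)"
  by (simp add: weierstrass_factor_def weierstrass_poly_def)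

lemma weierstrass_poly_holomorphic [holomorphic_intros]:
  "f holomorphic_on A \<Longrightarrow> (\<lambda>z. weierstrass_poly n (f z)) holomorphic_on A"
  unfolding weierstrass_poly_def by (auto intro!: holomorphic_intros)

text \<open>In a disc of radius r, all but finitely many arguments w / a n have norm at most 1/2,
  where the primary factor of degree p differs from 1 by at most 3 |w / a n|^(p+1). Summability of
  these powers is the defining condition of the locale.\<close>

lemma (in weierstrass_product) factor_bound_on_compact:
  assumes "compact C"
  shows "\<exists>M. summable M \<and>
    (\<forall>\<^sub>F n in sequentially. \<forall>w\<in>C. norm (weierstrass_factor (p n) (w / a n) - 1) \<le> M n)"
proof -
  obtain r where r: "r > 0" "\<And>w. w \<in> C \<Longrightarrow> norm w \<le> r"
    using compact_imp_bounded[OF assms] unfolding bounded_pos by blast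
  have "summable (\<lambda>n. 3 * (r / norm (a n)) ^ Suc (p n))"
    using summable_a_p[OF r(1)] by (rule summable_mult)
  moreover have "\<forall>\<^sub>F n in sequentially. norm (a n) > 2 * r"
    using filterlim_a by (metis filterlim_at_infinity_imp_norm_at_top filterlim_at_top_dense)
  hence "\<forall>\<^sub>F n in sequentially. \<forall>w\<in>C.
      norm (weierstrass_factor (p n) (w / a n) - 1) \<le> 3 * (r / norm (a n)) ^ Suc (p n)"
  proof eventually_elim
    case (elim n)
    show ?case
    proof
      fix w assume "w \<in> C"
      hence w: "norm (w / a n) \<le> r / norm (a n)"
        using r by (simp add: norm_divide divide_right_mono)
      also have "r / norm (a n) \<le> 1 / 2" using elim r(1) by (subst pos_divide_le_eq) linarith+
      finally have "norm (weierstrass_factor (p n) (w / a n) - 1) \<le> 3 * norm (w / a n) ^ Suc (p n)"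
        by (rule weierstrass_factor_bound)
      also have "\<dots> \<le> 3 * (r / norm (a n)) ^ Suc (p n)"
        by (intro mult_left_mono power_mono w) auto
      finally show "norm (weierstrass_factor (p n) (w / a n) - 1) \<le> 3 * (r / norm (a n)) ^ Suc (p n)" .
    qed
  qed
  ultimately show ?thesis by blast
qed

text \<open>The sequence \<open>b\<close> and the degrees \<open>p\<close> are left general so that
  the standard product and both of its modifications are decomposed by the same argument.\<close>

lemma isotropic_decomposition_of_representation:
  assumes lam: "0 < lam" and D: "open D" "simply_connected D"
    and D0: "0 \<notin> D" and Db: "\<And>n. n \<ge> 1 \<Longrightarrow> b n \<notin> D"
    and W: "weierstrass_product (\<lambda>n. b (Suc n)) (\<lambda>n. p (Suc n))"
    and L: "L holomorphic_on D" "\<And>w. w \<in> D \<Longrightarrow> exp (L w) = f w"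
    and rep: "weierstrass_representation f k b p g"
  shows "isotropic_decomposition \<theta> lam (lin_AC \<theta> lam ` D) k b p g
           (\<lambda>q. Re (cis \<theta> * L (inv (lin_AC \<theta> lam) q)))"
proof -
  define U where "U = lin_AC \<theta> lam ` D"
  define Z where "Z = inv (lin_AC \<theta> lam)"
  define S where "S = (\<lambda>w. (Re w, Im w)) ` D"
  define cx where "cx q = Complex (fst q) (snd q)" for q
  have U: "open U" unfolding U_def by (rule open_lin_AC_image[OF lam D(1)])
  have ZU: "Z q \<in> D" if "q \<in> U" for q
    using that inv_lin_AC_image[OF lam] by (simp add: U_def Z_def)
  have Ainv: "inv (lin_A \<theta> lam) = (\<lambda>q. (Re (Z q), Im (Z q)))"
    unfolding Z_def by (rule inv_lin_A[OF lam])
  have AU: "inv (lin_A \<theta> lam) ` U = S"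
    unfolding Ainv U_def S_def image_image Z_def
    by (simp add: bij_is_inj[OF bij_lin_AC[OF lam]])
  have graph: "isotropic_minimal_graph U hh"
    if "F holomorphic_on D" "\<And>q. q \<in> U \<Longrightarrow> hh q = Re (c * F (Z q))" for hh F c
    by (rule isotropic_minimal_graph_inv_lin_AC[OF lam U D(1) that(1)])
      (use that(2) ZU in \<open>auto simp: Z_def\<close>)
  have graph': "isotropic_minimal_graph UNIV hh"
    if "F holomorphic_on UNIV" "\<And>q. hh q = Re (c * F (Z q))" for hh F c
    by (rule isotropic_minimal_graph_inv_lin_AC[OF lam open_UNIV open_UNIV that(1)])
      (use that(2) in \<open>auto simp: Z_def\<close>)
  interpret weierstrass_product "\<lambda>n. b (Suc n)" "\<lambda>n. p (Suc n)" by (rule W)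
  have b0: "b n \<noteq> 0" if "n \<ge> 1" for n
    using a_nonzero[of "n - 1"] that by simp
  have g: "g holomorphic_on UNIV" using rep by (simp add: weierstrass_representation_def)
  obtain l0 where l0: "l0 holomorphic_on D" "\<And>w. w \<in> D \<Longrightarrow> w = exp (l0 w)"
    using simply_connected_imp_holomorphic_log[OF holomorphic_on_ident D(2) open_imp_locally_path_connected[OF D(1)]] D0
    by metis
  \<comment> \<open>A logarithm of the bare product: \<open>l0\<close> and \<open>g\<close> are
    fixed beforehand, so every remaining ambiguity of \<open>L\<close> is passed to the
    series.\<close>
  define L' where "L' w = L w - of_nat k * l0 w - g w" for w
  have L': "L' holomorphic_on D"
    unfolding L'_def by (intro holomorphic_intros L l0 holomorphic_on_subset[OF g]) auto
  have prod: "(\<lambda>n. weierstrass_factor (p (Suc n)) (w / b (Suc n))) has_prod exp (L' w)" if w: "w \<in> D" for w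
  proof -
    obtain Q where Q: "(\<lambda>n. weierstrass_factor (p (Suc n)) (w / b (Suc n))) has_prod Q"
      "f w = w ^ k * exp (g w) * Q"
      using rep unfolding weierstrass_representation_def by blast
    have "exp (of_nat k * l0 w) = w ^ k" using l0(2)[OF w] by (simp add: exp_of_nat_mult)
    moreover have "w \<noteq> 0" using w D0 by auto
    ultimately have "exp (L' w) = Q"
      unfolding L'_def using L(2)[OF w] Q(2) by (simp add: exp_diff)
    thus ?thesis using Q(1) by simp
  qed
  have nz: "weierstrass_factor (p (Suc n)) (w / b (Suc n)) \<noteq> 0" if "w \<in> D" for n w
    using that Db[of "Suc n"] b0[of "Suc n"] by auto
  obtain \<mu> where \<mu>: "\<And>n. \<mu> n holomorphic_on D"
    "\<And>n w. w \<in> D \<Longrightarrow> exp (\<mu> n w) = weierstrass_factor (p (Suc n)) (w / b (Suc n))"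
    "\<And>w. w \<in> D \<Longrightarrow> (\<lambda>n. \<mu> n w) sums L' w"
  proof (rule has_prod_imp_branches_sums[OF D _ nz _ holomorphic_on_imp_continuous_on[OF L'] prod])
    show "(\<lambda>w. weierstrass_factor (p (Suc n)) (w / b (Suc n))) holomorphic_on D" for n
      using b0[of "Suc n"] by (intro holomorphic_intros) auto
  qed (use factor_bound_on_compact in blast)+
  \<comment> \<open>Removing the polynomial from a logarithm of the primary factor leaves a
    logarithm of 1 - w / b n. The shift \<open>n - 1\<close> is due to \<open>\<mu>\<close> counting
    from 0 and the zeros from 1.\<close>
  define l where "l n w = \<mu> (n - 1) w - weierstrass_poly (p n) (w / b n)" for n w
  have l: "l n holomorphic_on D" if "n \<ge> 1" for n
    unfolding l_def using b0[OF that] by (intro holomorphic_intros \<mu>) auto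
  have exp_l: "exp (l n w) = 1 - w / b n" if "w \<in> D" "n \<ge> 1" for n w
    using \<mu>(2)[OF that(1), of "n - 1"] that(2) unfolding l_def
    by (simp add: exp_diff weierstrass_factor_eq)
  define Hel where "Hel q = Im (l0 (cx q))" for q
  define dHel where "dHel n q = Im (l n (cx q))" for n q
  have cxA: "cx (Re (Z q), Im (Z q)) = Z q" for q by (simp add: cx_def)
  have lr: "dil_log_rev (b n) (Re (Z q), Im (Z q)) = Re (l n (Z q))" if "q \<in> U" "n \<ge> 1" for n q
    using exp_l[OF ZU[OF that(1)] that(2), symmetric]
    by (simp add: dil_log_rev_def)
  have lr0: "log_rev (Re (Z q), Im (Z q)) = Re (l0 (Z q))" if "q \<in> U" for q
    using l0(2)[OF ZU[OF that]] by (metis log_rev_eq cx_def cxA ln_exp norm_exp_eq_Re)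
  have P: "weierstrass_poly (p n) (1 / b n * Z q) = weierstrass_poly (p n) (Z q / b n)" for n q
    by simp
  show ?thesis
    unfolding isotropic_decomposition_def Let_def U_def[symmetric] Z_def[symmetric] AU
  proof (intro exI[of _ Hel] exI[of _ dHel] conjI allI impI ballI)
    show "helicoid S Hel"
      unfolding S_def Hel_def cx_def
      by (rule helicoid_Im_log) (use l0 in \<open>auto intro: holomorphic_on_imp_continuous_on\<close>)
    fix n :: nat assume n: "1 \<le> n"
    have cl: "continuous_on D (l n)" by (rule holomorphic_on_imp_continuous_on[OF l[OF n]])
    show "dil_helicoid (b n) S (dHel n)"
      unfolding S_def dHel_def[abs_def] cx_def
      by (rule dil_helicoid_Im_log[OF cl exp_l b0]) (use n in auto)
    show "\<exists>T K. plane_similarity T \<and> helicoid (T ` S) K \<and>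
      (\<forall>q\<in>S. dHel n q = K (T q)) \<and> (\<forall>q. dil_log_rev (b n) q = log_rev (T q))"
      unfolding S_def dHel_def[abs_def] cx_def
      by (rule dil_helicoid_similar[OF cl exp_l b0]) (use n in auto)
    show "isotropic_minimal_graph U (\<lambda>q. - sin \<theta> * dHel n (inv (lin_A \<theta> lam) q))"
      unfolding dHel_def Ainv cxA by (rule graph[OF l[OF n], of _ "\<i> * of_real (sin \<theta>)"]) simp
    show "isotropic_minimal_graph UNIV (\<lambda>q. - sin \<theta> * Im (weierstrass_poly (p n) (1 / b n * Z q)))"
      by (rule graph'[of "\<lambda>z. weierstrass_poly (p n) (z / b n)" _ "\<i> * of_real (sin \<theta>)"])
       (use b0[OF n] in \<open>auto intro!: holomorphic_intros\<close>)
    show "isotropic_minimal_graph UNIV (\<lambda>q. cos \<theta> * Re (weierstrass_poly (p n) (1 / b n * Z q)))"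
      by (rule graph'[of "\<lambda>z. weierstrass_poly (p n) (z / b n)" _ "of_real (cos \<theta>)"])
       (use b0[OF n] in \<open>auto intro!: holomorphic_intros\<close>)
    show "isotropic_minimal_graph U (\<lambda>q. cos \<theta> * dil_log_rev (b n) (inv (lin_A \<theta> lam) q))"
      unfolding Ainv by (rule graph[OF l[OF n], of _ "of_real (cos \<theta>)"]) (simp add: lr[OF _ n])
  next
    show "isotropic_minimal_graph U (\<lambda>q. - sin \<theta> * Hel (inv (lin_A \<theta> lam) q))"
      unfolding Hel_def Ainv cxA by (rule graph[OF l0(1), of _ "\<i> * of_real (sin \<theta>)"]) simp
    show "isotropic_minimal_graph U (\<lambda>q. cos \<theta> * log_rev (inv (lin_A \<theta> lam) q))"
      unfolding Ainv by (rule graph[OF l0(1), of _ "of_real (cos \<theta>)"]) (simp add: lr0)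
    show "isotropic_minimal_graph UNIV (\<lambda>q. - sin \<theta> * Im (g (Z q)))"
      by (rule graph'[OF g, of _ "\<i> * of_real (sin \<theta>)"]) simp
    show "isotropic_minimal_graph UNIV (\<lambda>q. cos \<theta> * Re (g (Z q)))"
      by (rule graph'[OF g, of _ "of_real (cos \<theta>)"]) simp
  next
    fix q assume q: "q \<in> U"
    define w where "w = Z q"
    have w: "w \<in> D" using ZU[OF q] by (simp add: w_def)
    \<comment> \<open>Joint summation lets the polynomial subtracted in \<open>l\<close> cancel, so
      the terms are multiples of the imaginary and real parts of \<open>\<mu> n w\<close>, whose
      series is known to converge.\<close>
    have eqs: "- sin \<theta> * dHel (Suc n) (inv (lin_A \<theta> lam) q)
          + - sin \<theta> * Im (weierstrass_poly (p (Suc n)) (1 / b (Suc n) * Z q)) = - sin \<theta> * Im (\<mu> n w)"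
      "cos \<theta> * dil_log_rev (b (Suc n)) (inv (lin_A \<theta> lam) q)
          + cos \<theta> * Re (weierstrass_poly (p (Suc n)) (1 / b (Suc n) * Z q)) = cos \<theta> * Re (\<mu> n w)" for n
      unfolding P Ainv dHel_def cxA by (simp_all add: lr[OF q] l_def w_def algebra_simps)
    have s1: "(\<lambda>n. - sin \<theta> * Im (\<mu> n w)) sums (- sin \<theta> * Im (L' w))"
      by (intro sums_mult sums_Im \<mu> w)
    have s2: "(\<lambda>n. cos \<theta> * Re (\<mu> n w)) sums (cos \<theta> * Re (L' w))"
      by (intro sums_mult sums_Re \<mu> w)
    show "summable (\<lambda>n. - sin \<theta> * dHel (Suc n) (inv (lin_A \<theta> lam) q)
          + - sin \<theta> * Im (weierstrass_poly (p (Suc n)) (1 / b (Suc n) * Z q)))"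
      unfolding eqs using s1 by (rule sums_summable)
    show "summable (\<lambda>n. cos \<theta> * dil_log_rev (b (Suc n)) (inv (lin_A \<theta> lam) q)
          + cos \<theta> * Re (weierstrass_poly (p (Suc n)) (1 / b (Suc n) * Z q)))"
      unfolding eqs using s2 by (rule sums_summable)
    have Lw: "L w = of_nat k * l0 w + L' w + g w" by (simp add: L'_def)
    show "Re (cis \<theta> * L (Z q)) =
       ((\<Sum>j=1..k. - sin \<theta> * Hel (inv (lin_A \<theta> lam) q))
        + (\<Sum>n. - sin \<theta> * dHel (Suc n) (inv (lin_A \<theta> lam) q)
             + - sin \<theta> * Im (weierstrass_poly (p (Suc n)) (1 / b (Suc n) * Z q)))
        + - sin \<theta> * Im (g (Z q)))
       + ((\<Sum>j=1..k. cos \<theta> * log_rev (inv (lin_A \<theta> lam) q))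
        + (\<Sum>n. cos \<theta> * dil_log_rev (b (Suc n)) (inv (lin_A \<theta> lam) q)
             + cos \<theta> * Re (weierstrass_poly (p (Suc n)) (1 / b (Suc n) * Z q)))
        + cos \<theta> * Re (g (Z q)))"
      unfolding eqs sums_unique[OF s1, symmetric] sums_unique[OF s2, symmetric]
      unfolding Ainv Hel_def cxA lr0[OF q]
      unfolding w_def[symmetric] Lw
      by (simp add: algebra_simps)
  qed
qed

section \<open>Existence and modification of Weierstrass products\<close>

text \<open>A disc contains finitely many zeros of \<open>f\<close>, and each nonzero one is listed
  finitely often, so the sequence leaves every disc.\<close>

lemma lists_nonzero_zeros_filterlim:
  assumes f: "f holomorphic_on UNIV" "\<exists>z. f z \<noteq> 0" and a: "lists_nonzero_zeros a f"
  shows "filterlim (\<lambda>n. a (Suc n)) at_infinity sequentially"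
proof -
  have a0: "a n \<noteq> 0" if "n \<ge> 1" for n using a that by (simp add: lists_nonzero_zeros_def)
  have fin: "finite {n. n \<ge> 1 \<and> a n = z}"
    and card: "int (card {n. n \<ge> 1 \<and> a n = z}) = zorder f z" if "z \<noteq> 0" for z
    using a that by (auto simp: lists_nonzero_zeros_def)
  have zero: "f (a n) = 0" if "n \<ge> 1" for n
  proof (rule ccontr)
    assume "f (a n) \<noteq> 0"
    hence "zorder f (a n) = 0"
      using f by (intro zorder_eq_0I) (auto simp: analytic_on_open holomorphic_on_imp_analytic_at)
    hence "{m. m \<ge> 1 \<and> a m = a n} = {}" using fin[OF a0[OF that]] card[OF a0[OF that]] by simp
    thus False using that by blast
  qed
  \<comment> \<open>The list is infinite, so \<open>f\<close> does vanish at \<open>a 1\<close>; as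
    it is not identically zero, it cannot be constant.\<close>
  have nc: "\<not> f constant_on UNIV"
    using f(2) zero[of 1] unfolding constant_on_def by (metis UNIV_I order_refl)
  have "\<forall>\<^sub>F n in sequentially. R \<le> norm (a (Suc n))" for R
  proof -
    have "finite {z \<in> cball 0 R. f z = 0}"
      by (rule holomorphic_compact_finite_zeros[OF f(1) _ _ _ _ nc]) auto
    hence "finite (\<Union>z\<in>{z \<in> cball 0 R. f z = 0} - {0}. {n. n \<ge> 1 \<and> a n = z})"
      using fin by blast
    hence "finite {n. n \<ge> 1 \<and> norm (a n) < R}"
      by (rule rev_finite_subset) (use a0 zero in auto)
    hence "finite (Suc -` {n. n \<ge> 1 \<and> norm (a n) < R})" by (rule finite_vimageI) simp
    hence "finite {n. \<not> R \<le> norm (a (Suc n))}"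
      by (rule rev_finite_subset) auto
    thus ?thesis by (simp add: eventually_cofinite flip: cofinite_eq_sequentially)
  qed
  thus ?thesis unfolding filterlim_at_infinity_conv_norm_at_top filterlim_at_top by blast
qed

text \<open>Once |b n| > 2r, the n-th term is at most (1/2)^n because its exponent exceeds n; a
  geometric series then dominates.\<close>

lemma weierstrass_productI:
  assumes nz: "\<And>n. b n \<noteq> 0" and lim: "filterlim b at_infinity sequentially" and p: "\<And>n. n \<le> p n"
  shows "weierstrass_product b p"
proof
  fix r :: real assume r: "r > 0"
  have ev: "\<forall>\<^sub>F n in sequentially. norm (b n) > 2 * r"
    using lim by (metis filterlim_at_infinity_imp_norm_at_top filterlim_at_top_dense)
  show "summable (\<lambda>n. (r / norm (b n)) ^ Suc (p n))"
  proof (rule summable_comparison_test_ev)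
    show "summable (\<lambda>n. (1 / 2 :: real) ^ n)" by (simp add: summable_geometric_iff)
    show "\<forall>\<^sub>F n in sequentially. norm ((r / norm (b n)) ^ Suc (p n)) \<le> (1 / 2) ^ n"
      using ev
    proof eventually_elim
      case (elim n)
      have "r / norm (b n) \<le> 1 / 2" using elim r by (subst pos_divide_le_eq) linarith+
      hence "(r / norm (b n)) ^ Suc (p n) \<le> (1 / 2) ^ Suc (p n)" using r by (intro power_mono) auto
      also have "\<dots> \<le> (1 / 2 :: real) ^ n" using p[of n] by (intro power_decreasing) auto
      finally show ?case using r by simp
    qed
  qed
qed (use assms in auto)

text \<open>The function z^k times the canonical product has the same order as \<open>f\<close> at
  every point, so the quotient is entire without zeros and is the exponential of an entire
  \<open>g\<close>.\<close>

lemma weierstrass_representation_exists: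
  assumes f: "f holomorphic_on UNIV" "\<exists>z. f z \<noteq> 0" and a: "lists_nonzero_zeros a f"
    and k: "zorder f 0 = int k"
    and W: "weierstrass_product (\<lambda>n. a (Suc n)) (\<lambda>n. p (Suc n))"
  shows "\<exists>g. weierstrass_representation f k a p g"
proof -
  interpret W: weierstrass_product "\<lambda>n. a (Suc n)" "\<lambda>n. p (Suc n)" by (rule W)
  define F where "F z = z ^ k * W.f z" for z
  have F: "F holomorphic_on UNIV" unfolding F_def by (intro holomorphic_intros)
  have W0: "W.f 0 \<noteq> 0" using W.zero[of 0] W.a_nonzero by (metis rangeE)
  have ordF: "zorder F z = zorder f z" for z
  proof (cases "z = 0")
    case True
    have "zorder F 0 = int k"
      by (rule zorder_eqI[of UNIV _ W.f]) (use W0 in \<open>auto simp: F_def intro: W.holomorphic\<close>)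
    thus ?thesis using True k by simp
  next
    case False
    have "\<forall>\<^sub>F w in at z. W.f w \<noteq> 0 \<and> w \<in> UNIV"
      by (rule non_zero_neighbour_alt[OF W.holomorphic _ _ _ _ W0]) auto
    moreover have "\<forall>\<^sub>F w in at z. w \<noteq> 0"
      by (rule eventually_neq_at_within)
    ultimately have ev: "\<forall>\<^sub>F w in at z. w ^ k * W.f w \<noteq> 0" by eventually_elim simp
    have "zorder F z = zorder (\<lambda>w. w ^ k) z + zorder W.f z"
      unfolding F_def by (intro zorder_times_analytic ev analytic_intros W.analytic)
    also have "zorder (\<lambda>w. w ^ k) z = 0"
      using False by (intro zorder_eq_0I analytic_intros) auto
    also have "zorder W.f z = int (card ((\<lambda>n. a (Suc n)) -` {z}))" by (rule W.zorder)
    also have "card ((\<lambda>n. a (Suc n)) -` {z}) = card {n. n \<ge> 1 \<and> a n = z}"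
    proof (rule bij_betw_same_card)
      show "bij_betw Suc ((\<lambda>n. a (Suc n)) -` {z}) {n. n \<ge> 1 \<and> a n = z}"
        by (rule bij_betw_byWitness[of _ "\<lambda>n. n - 1"]) auto
    qed
    finally show ?thesis using a False by (simp add: lists_nonzero_zeros_def)
  qed
  have F1: "\<exists>z\<in>UNIV. F z \<noteq> 0"
  proof -
    have "\<forall>\<^sub>F w in at 0. W.f w \<noteq> 0 \<and> w \<in> UNIV"
      by (rule non_zero_neighbour_alt[OF W.holomorphic _ _ _ _ W0]) auto
    moreover have "\<forall>\<^sub>F w in at (0::complex). w \<noteq> 0" by (simp add: eventually_at_filter)
    ultimately have "\<forall>\<^sub>F w in at 0. F w \<noteq> 0" by eventually_elim (simp add: F_def)
    thus ?thesis using eventually_happens'[of "at (0::complex)"] by auto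
  qed
  \<comment> \<open>For entire functions that are not identically zero, the order is positive at the
    zeros and 0 elsewhere; equal orders therefore give equal zero sets.\<close>
  have zero: "F z = 0 \<longleftrightarrow> f z = 0" for z
    using zorder_exist_zero[OF F open_UNIV connected_UNIV UNIV_I F1, of z, THEN conjunct1]
      zorder_exist_zero[OF f(1) open_UNIV connected_UNIV UNIV_I, of z, THEN conjunct1] f(2) ordF[of z]
    by (auto split: if_splits)
  obtain h where h: "h holomorphic_on UNIV" "\<And>z. h z \<noteq> 0" "\<And>z. f z = h z * F z"
    using holomorphic_zorder_factorization[OF f(1) open_UNIV connected_UNIV F] zero ordF by auto
  obtain g where g: "g holomorphic_on UNIV" "\<And>z. h z = exp (g z)"
    using simply_connected_imp_holomorphic_log[OF h(1) _ _ h(2)]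
    by (metis UNIV_I convex_UNIV convex_imp_simply_connected open_UNIV open_imp_locally_path_connected)
  have "weierstrass_representation f k a p g"
    unfolding weierstrass_representation_def
    using g h(3) W.has_prod by (auto simp: F_def intro!: exI[of _ "W.f _"])
  thus ?thesis by blast
qed

text \<open>Once a partial product includes all indices in \<open>A\<close>, old and new partial
  products differ by exactly exp psi, which is compensated by subtracting psi from
  \<open>g\<close>.\<close>

lemma weierstrass_representation_modify:
  assumes rep: "weierstrass_representation f k b p g"
    and W: "weierstrass_product (\<lambda>n. b' (Suc n)) (\<lambda>n. p' (Suc n))"
    and \<psi>: "\<psi> holomorphic_on UNIV" and A: "finite A"
    and out: "\<And>n. n \<notin> A \<Longrightarrow> b' (Suc n) = b (Suc n) \<and> p' (Suc n) = p (Suc n)"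
    and in_A: "\<And>z. (\<Prod>n\<in>A. weierstrass_factor (p' (Suc n)) (z / b' (Suc n))) =
        exp (\<psi> z) * (\<Prod>n\<in>A. weierstrass_factor (p (Suc n)) (z / b (Suc n)))"
  shows "weierstrass_representation f k b' p' (\<lambda>z. g z - \<psi> z)"
  unfolding weierstrass_representation_def
proof (intro conjI allI)
  have g: "g holomorphic_on UNIV" using rep by (simp add: weierstrass_representation_def)
  show "(\<lambda>z. g z - \<psi> z) holomorphic_on UNIV" by (intro holomorphic_intros g \<psi>)
  fix z
  define u where "u n = weierstrass_factor (p (Suc n)) (z / b (Suc n))" for n
  define v where "v n = weierstrass_factor (p' (Suc n)) (z / b' (Suc n))" for n
  obtain Q where Q: "u has_prod Q" "f z = z ^ k * exp (g z) * Q"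
    using rep unfolding weierstrass_representation_def u_def by blast
  have "v has_prod (exp (\<psi> z) * Q)"
  proof (rule convergent_prod_tendsto_imp_has_prod)
    \<comment> \<open>At a zero of the product the partial products tend to 0, which alone does not
      amount to \<open>has_prod\<close>; convergence is therefore taken from the locale.\<close>
    show "convergent_prod v" unfolding v_def by (rule weierstrass_product.convergent[OF W])
    obtain N where N: "A \<subseteq> {..N}" using A by (meson finite_nat_iff_bounded_le)
    have "\<forall>\<^sub>F M in sequentially. exp (\<psi> z) * (\<Prod>n\<le>M. u n) = (\<Prod>n\<le>M. v n)"
      using eventually_ge_at_top[of N]
    proof eventually_elim
      case (elim M)
      hence AM: "A \<subseteq> {..M}" using N by auto
      have "(\<Prod>n\<in>{..M} - A. v n) = (\<Prod>n\<in>{..M} - A. u n)"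
        using out by (intro prod.cong) (auto simp: u_def v_def)
      thus ?case
        using in_A[of z] by (simp add: prod.subset_diff[OF AM] u_def v_def mult_ac)
    qed
    moreover have "(\<lambda>M. exp (\<psi> z) * (\<Prod>n\<le>M. u n)) \<longlonglongrightarrow> exp (\<psi> z) * Q"
      by (intro tendsto_mult tendsto_const has_prod_imp_tendsto Q)
    ultimately show "(\<lambda>M. \<Prod>n\<le>M. v n) \<longlonglongrightarrow> exp (\<psi> z) * Q" by (rule Lim_transform_eventually[rotated])
  qed
  thus "\<exists>Q. (\<lambda>n. weierstrass_factor (p' (Suc n)) (z / b' (Suc n))) has_prod Q \<and>
      f z = z ^ k * exp (g z - \<psi> z) * Q"
    unfolding v_def using Q(2) by (intro exI[of _ "exp (\<psi> z) * Q"]) (simp add: exp_diff)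
qed

text \<open>Either sin theta or cos theta may vanish, so the two equations are added: Re (e^(i
  theta) c w^(m+1)) would be constant on the open set \<open>D\<close>. Its derivative would vanish
  there, which is impossible away from 0. The exponent \<open>Suc m\<close> keeps constants
  out.\<close>

lemma different_entire_parts_monomial:
  assumes lam: "0 < lam" and D: "open D" "D \<noteq> {}" "0 \<notin> D" and c: "c \<noteq> 0"
    and g': "\<And>z. g' z = g z - c * z ^ Suc m"
  shows "different_entire_parts \<theta> lam (lin_AC \<theta> lam ` D) g g'"
  unfolding different_entire_parts_def Let_def
proof
  define C where "C = cis \<theta> * c"
  have C: "C \<noteq> 0" using c by (simp add: C_def)
  assume "\<exists>s d. \<forall>q\<in>lin_AC \<theta> lam ` D.
       - sin \<theta> * Im (g' (inv (lin_AC \<theta> lam) q)) = - sin \<theta> * Im (g (inv (lin_AC \<theta> lam) q)) + s \<and>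
       cos \<theta> * Re (g' (inv (lin_AC \<theta> lam) q)) = cos \<theta> * Re (g (inv (lin_AC \<theta> lam) q)) + d"
  then obtain s d where sd: "- sin \<theta> * Im (g' w) = - sin \<theta> * Im (g w) + s"
      "cos \<theta> * Re (g' w) = cos \<theta> * Re (g w) + d" if "w \<in> D" for w
    by (auto simp: bij_is_inj[OF bij_lin_AC[OF lam]])
  have const: "Re (C * w ^ Suc m) = - s - d" if "w \<in> D" for w
  proof -
    have "C * w ^ Suc m = cis \<theta> * (g w - g' w)" by (simp add: g' C_def)
    hence "Re (C * w ^ Suc m) = cos \<theta> * (Re (g w) - Re (g' w)) - sin \<theta> * (Im (g w) - Im (g' w))"
      by (simp only: times_complex.sel cis.sel minus_complex.sel)
    thus ?thesis using sd[OF that] by (simp add: algebra_simps)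
  qed
  obtain w where w: "w \<in> D" using D(2) by blast
  define e where "e = C * (of_nat (Suc m) * w ^ m)"
  have "((\<lambda>z. C * z ^ Suc m) has_field_derivative e) (at w)"
    unfolding e_def by (rule DERIV_cong[OF DERIV_cmult[OF DERIV_power[OF DERIV_ident]]]) simp
  hence "((\<lambda>z. Re (C * z ^ Suc m)) has_derivative (\<lambda>u. Re (e * u))) (at w)"
    unfolding has_field_derivative_def by (rule has_derivative_Re)
  moreover have "((\<lambda>z. Re (C * z ^ Suc m)) has_derivative (\<lambda>u. 0)) (at w)"
    by (rule has_derivative_transform_within_open[OF has_derivative_const D(1) w]) (simp only: const)
  ultimately have "(\<lambda>u. Re (e * u)) = (\<lambda>u. 0)" by (rule has_derivative_unique)
  \<comment> \<open>Evaluating the zero map at \<open>cnj e\<close> gives |e|^2 = 0.\<close>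
  hence "Re (e * cnj e) = 0" by metis
  hence "e = 0" by (simp add: complex_mult_cnj complex_eq_iff sum_power2_eq_zero_iff del: of_real_add)
  thus False using C w D(3) by (auto simp: e_def simp del: of_nat_Suc)
qed

section \<open>The deformed surface\<close>

text \<open>The factor belonging to \<open>b 1\<close> gains the term w^2/2 in its exponent, with w
  = z / b 1; this is the quadratic monomial that \<open>g\<close> loses.\<close>

lemma weierstrass_representation_raise_degree:
  assumes "weierstrass_representation f k b (\<lambda>n. n) g" and nz: "b 1 \<noteq> 0"
    and W: "weierstrass_product (\<lambda>n. b (Suc n)) (\<lambda>n. ((\<lambda>n. n)(1 := 2)) (Suc n))"
  shows "weierstrass_representation f k b ((\<lambda>n. n)(1 := 2)) (\<lambda>z. g z - 1 / (2 * (b 1)\<^sup>2) * z ^ 2)"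
proof (rule weierstrass_representation_modify[OF assms(1) W, of _ "{0}"])
  show "(\<lambda>z. 1 / (2 * (b 1)\<^sup>2) * z ^ 2) holomorphic_on UNIV" by (intro holomorphic_intros) (use nz in auto)
  have "weierstrass_factor 2 w = exp (w\<^sup>2 / 2) * weierstrass_factor 1 w" for w
    by (simp add: weierstrass_factor_eq weierstrass_poly_def numeral_2_eq_2 exp_add)
  thus "(\<Prod>n\<in>{0}. weierstrass_factor (((\<lambda>n. n)(1 := 2)) (Suc n)) (z / b (Suc n))) =
      exp (1 / (2 * (b 1)\<^sup>2) * z ^ 2) * (\<Prod>n\<in>{0}. weierstrass_factor (Suc n) (z / b (Suc n)))" for z
    by (simp add: power_divide mult.commute)
qed auto

text \<open>Degrees stay with positions, so the exchange raises the degree at one zero by one and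
  lowers it at the other. As the positions are consecutive, only the top terms w^(j+2)/(j+2) fail to
  cancel, and \<open>c\<close> is the coefficient of their difference.\<close>

lemma weierstrass_representation_transpose:
  fixes b :: "nat \<Rightarrow> complex" and j :: nat
  defines "\<sigma> \<equiv> Transposition.transpose (Suc j) (Suc (Suc j))"
  defines "c \<equiv> (1 / b (Suc j) ^ Suc (Suc j) - 1 / b (Suc (Suc j)) ^ Suc (Suc j)) / of_nat (Suc (Suc j))"
  assumes "weierstrass_representation f k b (\<lambda>n. n) g"
    and W: "weierstrass_product (\<lambda>n. (b \<circ> \<sigma>) (Suc n)) (\<lambda>n. Suc n)"
  shows "weierstrass_representation f k (b \<circ> \<sigma>) (\<lambda>n. n) (\<lambda>z. g z - c * z ^ Suc (Suc j))"
proof (rule weierstrass_representation_modify[OF assms(3) W, of _ "{j, Suc j}"])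
  show "(\<lambda>z. c * z ^ Suc (Suc j)) holomorphic_on UNIV" by (intro holomorphic_intros)
  show "(b \<circ> \<sigma>) (Suc n) = b (Suc n) \<and> Suc n = Suc n" if "n \<notin> {j, Suc j}" for n
    using that by (simp add: \<sigma>_def transpose_apply_other)
  fix z
  have P: "weierstrass_poly (Suc (Suc j)) w = weierstrass_poly (Suc j) w + w ^ Suc (Suc j) / of_nat (Suc (Suc j))" for w
    by (simp add: weierstrass_poly_def)
  define x y where "x = z / b (Suc j)" and "y = z / b (Suc (Suc j))"
  have c: "c * z ^ Suc (Suc j) = x ^ Suc (Suc j) / of_nat (Suc (Suc j)) - y ^ Suc (Suc j) / of_nat (Suc (Suc j))"
    unfolding c_def x_def y_def power_divide by (simp only: diff_divide_distrib left_diff_distrib) simp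
  have "weierstrass_factor (Suc j) y * weierstrass_factor (Suc (Suc j)) x =
      exp (c * z ^ Suc (Suc j)) * (weierstrass_factor (Suc j) x * weierstrass_factor (Suc (Suc j)) y)"
    unfolding weierstrass_factor_eq P c exp_add exp_diff by (simp add: mult_ac)
  thus "(\<Prod>n\<in>{j, Suc j}. weierstrass_factor (Suc n) (z / (b \<circ> \<sigma>) (Suc n))) =
      exp (c * z ^ Suc (Suc j)) * (\<Prod>n\<in>{j, Suc j}. weierstrass_factor (Suc n) (z / b (Suc n)))"
    by (simp add: \<sigma>_def x_def y_def)
qed simp

section \<open>Integration constants and the deformed curve\<close>

lemma DERIV_unique_antiderivative:
  fixes F G :: "complex \<Rightarrow> complex"
  assumes "open D" "connected D" "z \<in> D" "F z = G z" "w \<in> D"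
    and "\<And>v. v \<in> D \<Longrightarrow> (F has_field_derivative f v) (at v)"
    and "\<And>v. v \<in> D \<Longrightarrow> (G has_field_derivative f v) (at v)"
  shows "F w = G w"
proof -
  have "(\<lambda>v. F v - G v) constant_on D"
    by (rule has_field_derivative_0_imp_constant_on[OF _ assms(2,1)])
      (use DERIV_diff[OF assms(6,7)] in auto)
  then obtain c where c: "\<And>v. v \<in> D \<Longrightarrow> F v - G v = c" by (auto simp: constant_on_def)
  show ?thesis using c[OF assms(3)] c[OF assms(5)] assms(4) by simp
qed

text \<open>The factors lam and 1/lam cancel in the third integrand, and agreement at one point of
  the connected domain makes the new curve a componentwise multiple of \<open>\<Phi>\<close>. Since
  Re (-i u) = Im u, its first two real parts are those of multiplication by e^(i theta)/lam.\<close>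

lemma bonnet_lopez_ros_eq:
  assumes D: "open D" "connected D" and lam: "0 < lam"
    and \<Phi>: "isotropic_curve D (\<lambda>_. 1) G \<Phi>" "\<forall>w\<in>D. \<Phi> w = (w, - \<i> * w, L w)"
    and Y: "bonnet_lopez_ros D G \<Phi> \<theta> lam Y" and w: "w \<in> D"
  shows "Y w = (fst (lin_AC \<theta> lam w), snd (lin_AC \<theta> lam w), Re (cis \<theta> * L w))"
proof -
  obtain \<Psi> z where \<Psi>: "isotropic_curve D (\<lambda>_. cis \<theta> / of_real lam) (\<lambda>w. of_real lam * G w) \<Psi>"
    and z: "z \<in> D" "\<Psi> z = (case \<Phi> z of (a, b, c) \<Rightarrow>
                (cis \<theta> / of_real lam * a, cis \<theta> / of_real lam * b, cis \<theta> * c))"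
    and Y: "\<forall>w\<in>D. Y w = re3 (\<Psi> w)"
    using Y unfolding bonnet_lopez_ros_def by blast
  have d\<Phi>: "((\<lambda>z. fst (\<Phi> z)) has_field_derivative 1) (at v)"
      "((\<lambda>z. fst (snd (\<Phi> z))) has_field_derivative - \<i>) (at v)"
      "((\<lambda>z. snd (snd (\<Phi> z))) has_field_derivative 2 * G v) (at v)" if "v \<in> D" for v
    using \<Phi>(1) that unfolding isotropic_curve_def by auto
  have d\<Psi>: "((\<lambda>z. fst (\<Psi> z)) has_field_derivative cis \<theta> / of_real lam * 1) (at v)"
      "((\<lambda>z. fst (snd (\<Psi> z))) has_field_derivative cis \<theta> / of_real lam * - \<i>) (at v)"
      "((\<lambda>z. snd (snd (\<Psi> z))) has_field_derivative cis \<theta> * (2 * G v)) (at v)" if "v \<in> D" for v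
    using \<Psi> that lam unfolding isotropic_curve_def by (auto simp: mult_ac)
  have "fst (\<Psi> w) = cis \<theta> / of_real lam * fst (\<Phi> w)"
    by (rule DERIV_unique_antiderivative[OF D z(1) _ w d\<Psi>(1) DERIV_cmult[OF d\<Phi>(1)]])
      (use z in \<open>auto split: prod.splits\<close>)
  moreover have "fst (snd (\<Psi> w)) = cis \<theta> / of_real lam * fst (snd (\<Phi> w))"
    by (rule DERIV_unique_antiderivative[OF D z(1) _ w d\<Psi>(2) DERIV_cmult[OF d\<Phi>(2)]])
      (use z in \<open>auto split: prod.splits\<close>)
  moreover have "snd (snd (\<Psi> w)) = cis \<theta> * snd (snd (\<Phi> w))"
    by (rule DERIV_unique_antiderivative[OF D z(1) _ w d\<Psi>(3) DERIV_cmult[OF d\<Phi>(3)]])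
      (use z in \<open>auto split: prod.splits\<close>)
  ultimately have "\<Psi> w = (cis \<theta> / of_real lam * w, cis \<theta> / of_real lam * (- \<i> * w), cis \<theta> * L w)"
    using \<Phi>(2) w by (metis fst_conv prod.collapse snd_conv)
  thus ?thesis using Y w by (simp add: re3_def lin_AC_def algebra_simps diff_divide_distrib add_divide_distrib)
qed

theorem theorem3p10:
  fixes a :: "nat \<Rightarrow> complex" and f G L :: "complex \<Rightarrow> complex" and k :: nat
    and D :: "complex set" and \<Phi> :: "complex \<Rightarrow> complex \<times> complex \<times> complex"
    and h :: "real \<times> real \<Rightarrow> real" and Y :: "complex \<Rightarrow> real \<times> real \<times> real"
    and \<theta> lam :: real
  assumes "f holomorphic_on UNIV" and "\<exists>z. f z \<noteq> 0"
    and "lists_nonzero_zeros a f" and "zorder f 0 = int k"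
    and "open D" and "D \<noteq> {}" and "simply_connected D"
    and "0 \<notin> D" and "\<forall>n\<ge>1. a n \<notin> D"
    and "\<forall>w\<in>D. exp (L w) = f w"
    and "isotropic_curve D (\<lambda>_. 1) G \<Phi>" and "\<forall>w\<in>D. \<Phi> w = (w, - \<i> * w, L w)"
    and "is_graph_of (\<lambda>w. re3 (\<Phi> w)) D ((\<lambda>w. (Re w, Im w)) ` D) h"
    and "\<forall>w\<in>D. h (Re w, Im w) = Re (L w)"
    and "0 < \<theta>" and "\<theta> \<le> 2 * pi" and "0 < lam"
    and "bonnet_lopez_ros D G \<Phi> \<theta> lam Y"
  shows "\<exists>h'. is_graph_of Y D (lin_AC \<theta> lam ` D) h'
     \<and> isotropic_minimal_graph (lin_AC \<theta> lam ` D) h'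
     \<and> (\<exists>g. weierstrass_representation f k a (\<lambda>n. n) g)
     \<and> (\<forall>g. weierstrass_representation f k a (\<lambda>n. n) g \<longrightarrow>
          isotropic_decomposition \<theta> lam (lin_AC \<theta> lam ` D) k a (\<lambda>n. n) g h'
        \<and> (\<exists>p g'. weierstrass_representation f k a p g'
             \<and> isotropic_decomposition \<theta> lam (lin_AC \<theta> lam ` D) k a p g' h'
             \<and> different_entire_parts \<theta> lam (lin_AC \<theta> lam ` D) g g')
        \<and> (\<exists>\<sigma> g'. bij_betw \<sigma> {1..} {1..}
             \<and> weierstrass_representation f k (a \<circ> \<sigma>) (\<lambda>n. n) g'
             \<and> isotropic_decomposition \<theta> lam (lin_AC \<theta> lam ` D) k (a \<circ> \<sigma>) (\<lambda>n. n) g' h'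
             \<and> different_entire_parts \<theta> lam (lin_AC \<theta> lam ` D) g g'))"
proof -
  note f = assms(1,2) and a = assms(3) and k = assms(4) and D = assms(5,6,7) and D0 = assms(8)
    and L = assms(10) and \<Phi> = assms(11,12) and lam = assms(17)
  define U where "U = lin_AC \<theta> lam ` D"
  define h' where "h' q = Re (cis \<theta> * L (inv (lin_AC \<theta> lam) q))" for q
  have a0: "a n \<noteq> 0" if "n \<ge> 1" for n using a that by (simp add: lists_nonzero_zeros_def)
  have aD: "a n \<notin> D" if "n \<ge> 1" for n using assms(9) that by simp
  have lim: "filterlim (\<lambda>n. a (Suc n)) at_infinity sequentially"
    by (rule lists_nonzero_zeros_filterlim[OF f a])
  have inv: "inv (lin_AC \<theta> lam) (lin_AC \<theta> lam w) = w" for w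
    by (rule inv_f_f[OF bij_is_inj[OF bij_lin_AC[OF lam]]])
  have Y: "Y w = (fst (lin_AC \<theta> lam w), snd (lin_AC \<theta> lam w), h' (lin_AC \<theta> lam w))" if "w \<in> D" for w
    unfolding h'_def inv
    by (rule bonnet_lopez_ros_eq[OF D(1) simply_connected_imp_connected[OF D(3)] lam \<Phi> assms(18) that])
  have pY: "proj_xy (Y w) = lin_AC \<theta> lam w" if "w \<in> D" for w
    using Y[OF that] by (simp add: proj_xy_def)
  \<comment> \<open>\<open>L\<close> is introduced as a pointwise logarithm of \<open>f\<close>; its
    holomorphy is inherited from the third component of \<open>\<Phi>\<close>, with which it agrees
    on \<open>D\<close>.\<close>
  have dL: "(L has_field_derivative 2 * G w) (at w)" if "w \<in> D" for w
  proof (rule has_field_derivative_transform_within_open[OF _ D(1) that])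
    show "((\<lambda>z. snd (snd (\<Phi> z))) has_field_derivative 2 * G w) (at w)"
      using \<Phi>(1) that by (auto simp: isotropic_curve_def)
  qed (use \<Phi>(2) in auto)
  hence hL: "L holomorphic_on D" using D(1) by (auto simp: holomorphic_on_open)
  have graph: "is_graph_of Y D U h'"
    unfolding is_graph_of_def
  proof
    have "bij_betw (lin_AC \<theta> lam) D U"
      unfolding U_def using bij_lin_AC[OF lam] by (metis bij_betw_imp_inj_on inj_on_imp_bij_betw inj_on_subset subset_UNIV)
    thus "bij_betw (\<lambda>w. proj_xy (Y w)) D U"
      using bij_betw_cong[of D "\<lambda>w. proj_xy (Y w)" "lin_AC \<theta> lam" U] pY by blast
    show "\<forall>w\<in>D. Y w = (fst (proj_xy (Y w)), snd (proj_xy (Y w)), h' (proj_xy (Y w)))"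
      using Y pY by simp
  qed
  have U: "open U" unfolding U_def by (rule open_lin_AC_image[OF lam D(1)])
  have minimal: "isotropic_minimal_graph U h'"
    by (rule isotropic_minimal_graph_inv_lin_AC[OF lam U D(1) hL, of \<theta> _ "cis \<theta>"])
      (auto simp: h'_def U_def inv)
  have W: "weierstrass_product (\<lambda>n. a (Suc n)) (\<lambda>n. p (Suc n))" if "\<And>n. n \<le> p n" for p
    using that a0 lim by (intro weierstrass_productI) (auto intro: Suc_leD)
  have decomp: "isotropic_decomposition \<theta> lam U k b p g h'"
    if "weierstrass_representation f k b p g" "\<And>n. n \<ge> 1 \<Longrightarrow> b n \<notin> D"
      "weierstrass_product (\<lambda>n. b (Suc n)) (\<lambda>n. p (Suc n))" for b p g
    unfolding U_def h'_def[abs_def]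
    by (rule isotropic_decomposition_of_representation[OF lam D(1,3) D0 that(2,3) hL _ that(1)])
      (use L in auto)
  have ex: "\<exists>g. weierstrass_representation f k a (\<lambda>n. n) g"
    by (rule weierstrass_representation_exists[OF f a k W]) simp
  \<comment> \<open>Distinct zeros would not suffice, since their (j+2)-th powers may coincide;
    distinct moduli exclude this. Such a \<open>j\<close> exists because constant moduli contradict
    divergence to infinity.\<close>
  obtain j where j: "norm (a (Suc j)) \<noteq> norm (a (Suc (Suc j)))"
  proof -
    have False if eq: "\<And>j. norm (a (Suc j)) = norm (a (Suc (Suc j)))"
    proof -
      have const: "norm (a (Suc n)) = norm (a 1)" for n by (induction n) (use eq in auto)
      have "\<forall>\<^sub>F n in sequentially. norm (a (Suc n)) > norm (a 1)"
        using lim by (metis filterlim_at_infinity_imp_norm_at_top filterlim_at_top_dense)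
      then obtain n where "norm (a (Suc n)) > norm (a 1)"
        using eventually_happens'[OF sequentially_bot] by blast
      thus False using const[of n] by linarith
    qed
    thus ?thesis using that by blast
  qed
  define \<sigma> where "\<sigma> = Transposition.transpose (Suc j) (Suc (Suc j))"
  have \<sigma>: "bij_betw \<sigma> {1..} {1..}"
    unfolding \<sigma>_def by (intro permutes_imp_bij permutes_swap_id) auto
  have \<sigma>1: "\<sigma> n \<ge> 1" if "n \<ge> 1" for n using bij_betwE[OF \<sigma>] that by auto
  have "\<forall>\<^sub>F n in sequentially. (a \<circ> \<sigma>) (Suc n) = a (Suc n)"
    using eventually_gt_at_top[of "Suc j"]
    by eventually_elim (simp add: \<sigma>_def transpose_apply_other)
  hence lim\<sigma>: "filterlim (\<lambda>n. (a \<circ> \<sigma>) (Suc n)) at_infinity sequentially"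
    using lim by (simp only: filterlim_cong[OF refl refl])
  have W\<sigma>: "weierstrass_product (\<lambda>n. (a \<circ> \<sigma>) (Suc n)) (\<lambda>n. Suc n)"
    by (rule weierstrass_productI[OF _ lim\<sigma>]) (use a0 \<sigma>1 in auto)
  \<comment> \<open>Raising a degree, unlike lowering it, preserves \<open>n \<le> p n\<close>, the
    condition of \<open>W\<close>.\<close>
  define p where "p = (\<lambda>n :: nat. n)(1 := 2)"
  have Wp: "weierstrass_product (\<lambda>n. a (Suc n)) (\<lambda>n. p (Suc n))"
    by (rule W) (simp add: p_def)
  define c where "c = (1 / a (Suc j) ^ Suc (Suc j) - 1 / a (Suc (Suc j)) ^ Suc (Suc j)) / of_nat (Suc (Suc j))"
  have c: "c \<noteq> 0"
  proof
    assume "c = 0"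
    hence "a (Suc j) ^ Suc (Suc j) = a (Suc (Suc j)) ^ Suc (Suc j)"
      unfolding c_def by (simp del: power_Suc of_nat_Suc)
    hence "norm (a (Suc j)) ^ Suc (Suc j) = norm (a (Suc (Suc j))) ^ Suc (Suc j)"
      by (metis norm_power)
    hence "norm (a (Suc j)) = norm (a (Suc (Suc j)))"
      by (rule power_eq_imp_eq_base) auto
    thus False using j by simp
  qed
  show ?thesis
    unfolding U_def[symmetric]
  proof (intro exI[of _ h'] conjI allI impI graph minimal ex)
    fix g assume g: "weierstrass_representation f k a (\<lambda>n. n) g"
    show "isotropic_decomposition \<theta> lam U k a (\<lambda>n. n) g h'"
      by (rule decomp[OF g aD W]) simp_all
    have g1: "weierstrass_representation f k a p (\<lambda>z. g z - 1 / (2 * (a 1)\<^sup>2) * z ^ 2)"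
      unfolding p_def
      by (rule weierstrass_representation_raise_degree[OF g]) (use a0 Wp in \<open>simp_all add: p_def\<close>)
    show "\<exists>p g'. weierstrass_representation f k a p g' \<and> isotropic_decomposition \<theta> lam U k a p g' h' \<and>
        different_entire_parts \<theta> lam U g g'"
    proof (intro exI conjI)
      show "different_entire_parts \<theta> lam U g (\<lambda>z. g z - 1 / (2 * (a 1)\<^sup>2) * z ^ 2)"
        unfolding U_def
        by (rule different_entire_parts_monomial[OF lam D(1,2) D0, of "1 / (2 * (a 1)\<^sup>2)" _ _ 1])
          (use a0 in \<open>simp_all add: numeral_2_eq_2\<close>)
    qed (rule g1 decomp[OF g1 aD Wp], assumption?)+
    have g2: "weierstrass_representation f k (a \<circ> \<sigma>) (\<lambda>n. n) (\<lambda>z. g z - c * z ^ Suc (Suc j))"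
      unfolding \<sigma>_def c_def
      by (rule weierstrass_representation_transpose[OF g]) (use W\<sigma> in \<open>simp add: \<sigma>_def\<close>)
    show "\<exists>\<sigma> g'. bij_betw \<sigma> {1..} {1..} \<and> weierstrass_representation f k (a \<circ> \<sigma>) (\<lambda>n. n) g' \<and>
        isotropic_decomposition \<theta> lam U k (a \<circ> \<sigma>) (\<lambda>n. n) g' h' \<and> different_entire_parts \<theta> lam U g g'"
    proof (intro exI conjI)
      show "isotropic_decomposition \<theta> lam U k (a \<circ> \<sigma>) (\<lambda>n. n) (\<lambda>z. g z - c * z ^ Suc (Suc j)) h'"
        by (rule decomp[OF g2 _ W\<sigma>]) (use aD \<sigma>1 in auto)
      show "different_entire_parts \<theta> lam U g (\<lambda>z. g z - c * z ^ Suc (Suc j))"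
        unfolding U_def by (rule different_entire_parts_monomial[OF lam D(1,2) D0 c refl])
    qed (rule \<sigma> g2)+
  qed
qed

end
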